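(* Let $F_r=\langle\gamma_1,\dots,\gamma_r\rangle$ be a free group of rank $r$ with free generators $\gamma_1,\dots,\gamma_r$. Then $$L_r=\{\gamma_{i_1}\cdots\gamma_{i_u} : 1\leq i_1<\dots<i_u\leq r \text{ and } 1\leq u\leq r\}$$ is a Burnside set for the class of all semisimple reflective representations of $F_r$ (of all degrees $n$).
   Context: Burnside set: let $F$ be a group, $\mathcal{C}$ a class of group homomorphisms with domain $F$, and $L\subseteq F$ a subset. We say that $L$ is a Burnside set for $\mathcal{C}$ if the following two conditions are equivalent for every $\rho\in\mathcal{C}$: (1) $\rho(\gamma)$ is torsion (i.e. has finite order) for all $\gamma\in L$; (2) $\rho$ has finite image. Reflective representation: let $(\cdot,\cdot)$ be the standard symmetric bilinear form on $\mathbb{C}^n$, so that $(x,x)=x_1^2+\dots+x_n^2$, and let $S(n)=\{v\in\mathbb{C}^n:(v,v)=1\}$. Given $u=(u_1,\dots,u_r)\in S(n)^r$, the reflective representation $\rho_u:F_r\to\mathrm{GL}_n(\mathbb{C})$ associated to $u$ is the representation such that $\rho_u(\gamma_i)(v)=v-2(v,u_i)u_i$ for all $v\in\mathbb{C}^n$ and $i=1,\dots,r$. A representation $\rho:F_r\to\mathrm{GL}_n(\mathbb{C})$ is called reflective if $\rho=\rho_u$ for some $u\in S(n)^r$. *)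

theory Defs
  imports "HOL-Algebra.Generated_Groups" "Jordan_Normal_Form.VS_Connect"
begin

subsection \<open>Burnside sets\<close>

definition torsion_element :: "('b, 'm) monoid_scheme \<Rightarrow> 'b \<Rightarrow> bool" where
  "torsion_element H x \<longleftrightarrow> x \<in> carrier H \<and> (\<exists>k::nat. k > 0 \<and> x [^]\<^bsub>H\<^esub> k = \<one>\<^bsub>H\<^esub>)"

text \<open>A class of group homomorphisms with domain \<open>F\<close> is given as a set of pairs
  \<open>(H, \<rho>)\<close> of a target group and a homomorphism into it, so that the
  target may vary within the class.\<close>

definition burnside_set ::
    "('a, 'm) monoid_scheme \<Rightarrow> ('b monoid \<times> ('a \<Rightarrow> 'b)) set \<Rightarrow> 'a set \<Rightarrow> bool" where
  "burnside_set F \<C> L \<longleftrightarrow>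
     group F \<and> (\<forall>(H, \<rho>) \<in> \<C>. group H \<and> \<rho> \<in> hom F H) \<and> L \<subseteq> carrier F \<and>
     (\<forall>(H, \<rho>) \<in> \<C>.
        (\<forall>\<gamma>\<in>L. torsion_element H (\<rho> \<gamma>)) \<longleftrightarrow> finite (\<rho> ` carrier F))"

subsection \<open>Free groups\<close>

definition list_mult :: "('a, 'm) monoid_scheme \<Rightarrow> 'a list \<Rightarrow> 'a" where
  "list_mult G xs = foldr (\<otimes>\<^bsub>G\<^esub>) xs \<one>\<^bsub>G\<^esub>"

text \<open>The letter \<open>(i, True)\<close> stands for \<open>g i\<close> and
  \<open>(i, False)\<close> for its inverse.\<close>

definition letter_value ::
    "('a, 'm) monoid_scheme \<Rightarrow> ('i \<Rightarrow> 'a) \<Rightarrow> 'i \<times> bool \<Rightarrow> 'a" where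
  "letter_value G g l = (if snd l then g (fst l) else inv\<^bsub>G\<^esub> (g (fst l)))"

definition reduced_word :: "('i \<times> bool) list \<Rightarrow> bool" where
  "reduced_word w \<longleftrightarrow> successively (\<lambda>l l'. \<not> (fst l = fst l' \<and> snd l \<noteq> snd l')) w"

text \<open>Injectivity of \<open>g\<close> on \<open>I\<close> is implied: for distinct \<open>i, j\<close> the word
  \<open>[(i, True), (j, False)]\<close> is reduced.\<close>

definition freely_generated ::
    "('a, 'm) monoid_scheme \<Rightarrow> 'i set \<Rightarrow> ('i \<Rightarrow> 'a) \<Rightarrow> bool" where
  "freely_generated G I g \<longleftrightarrow>
     group G \<and> g \<in> I \<rightarrow> carrier G \<and> generate G (g ` I) = carrier G \<and>
     (\<forall>w. w \<noteq> [] \<and> fst ` set w \<subseteq> I \<and> reduced_word w \<longrightarrow>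
        list_mult G (map (letter_value G g) w) \<noteq> \<one>\<^bsub>G\<^esub>)"

text \<open>The products of generators with strictly increasing indices.\<close>

definition increasing_products ::
    "('a, 'm) monoid_scheme \<Rightarrow> nat \<Rightarrow> (nat \<Rightarrow> 'a) \<Rightarrow> 'a set" where
  "increasing_products F r \<gamma> =
     {list_mult F (map \<gamma> is) | is.
        sorted_wrt (<) is \<and> set is \<subseteq> {1..r} \<and> 1 \<le> length is \<and> length is \<le> r}"

subsection \<open>Complex representations\<close>

definition GL :: "nat \<Rightarrow> complex mat monoid" where
  "GL n = units_of (ring_mat TYPE(complex) n ())"

definition invariant_subspace ::
    "('a, 'm) monoid_scheme \<Rightarrow> nat \<Rightarrow> ('a \<Rightarrow> complex mat) \<Rightarrow> complex vec set \<Rightarrow> bool" where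
  "invariant_subspace F n \<rho> W \<longleftrightarrow>
     subspace class_ring W (module_vec TYPE(complex) n) \<and>
     (\<forall>x\<in>carrier F. \<forall>v\<in>W. \<rho> x *\<^sub>v v \<in> W)"

definition irreducible_subrep ::
    "('a, 'm) monoid_scheme \<Rightarrow> nat \<Rightarrow> ('a \<Rightarrow> complex mat) \<Rightarrow> complex vec set \<Rightarrow> bool" where
  "irreducible_subrep F n \<rho> W \<longleftrightarrow>
     invariant_subspace F n \<rho> W \<and> W \<noteq> {0\<^sub>v n} \<and>
     (\<forall>U. invariant_subspace F n \<rho> U \<and> U \<subseteq> W \<longrightarrow> U = {0\<^sub>v n} \<or> U = W)"

text \<open>The space is the internal direct sum of finitely many irreducible
  subrepresentations: every vector is in a unique way a sum of components.\<close>

definition semisimple_rep ::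
    "('a, 'm) monoid_scheme \<Rightarrow> nat \<Rightarrow> ('a \<Rightarrow> complex mat) \<Rightarrow> bool" where
  "semisimple_rep F n \<rho> \<longleftrightarrow>
     (\<exists>(m::nat) W. (\<forall>j<m. irreducible_subrep F n \<rho> (W j)) \<and>
        (\<forall>v\<in>carrier_vec n. \<exists>!w. w \<in> (\<Pi>\<^sub>E j\<in>{..<m}. W j) \<and>
           v = finsum_vec TYPE(complex) n w {..<m}))"

subsection \<open>Reflective representations\<close>

text \<open>\<open>scalar_prod\<close> is the symmetric bilinear form, without complex conjugation.\<close>

definition unit_quadric :: "nat \<Rightarrow> complex vec set" where
  "unit_quadric n = {v \<in> carrier_vec n. v \<bullet> v = 1}"

definition is_reflective_rep_of ::
    "('a, 'm) monoid_scheme \<Rightarrow> nat \<Rightarrow> (nat \<Rightarrow> 'a) \<Rightarrow> nat \<Rightarrow> (nat \<Rightarrow> complex vec) \<Rightarrow>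
     ('a \<Rightarrow> complex mat) \<Rightarrow> bool" where
  "is_reflective_rep_of F r \<gamma> n u \<rho> \<longleftrightarrow>
     \<rho> \<in> hom F (GL n) \<and>
     (\<forall>i\<in>{1..r}. \<forall>v\<in>carrier_vec n.
        \<rho> (\<gamma> i) *\<^sub>v v = v - (2 * (v \<bullet> u i)) \<cdot>\<^sub>v u i)"

definition reflective_rep ::
    "('a, 'm) monoid_scheme \<Rightarrow> nat \<Rightarrow> (nat \<Rightarrow> 'a) \<Rightarrow> nat \<Rightarrow> ('a \<Rightarrow> complex mat) \<Rightarrow> bool" where
  "reflective_rep F r \<gamma> n \<rho> \<longleftrightarrow>
     (\<exists>u \<in> {1..r} \<rightarrow> unit_quadric n. is_reflective_rep_of F r \<gamma> n u \<rho>)"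

definition semisimple_reflective_reps ::
    "('a, 'm) monoid_scheme \<Rightarrow> nat \<Rightarrow> (nat \<Rightarrow> 'a) \<Rightarrow>
     (complex mat monoid \<times> ('a \<Rightarrow> complex mat)) set" where
  "semisimple_reflective_reps F r \<gamma> =
     {(GL n, \<rho>) | n \<rho>. reflective_rep F r \<gamma> n \<rho> \<and> semisimple_rep F n \<rho>}"

end

theory Submission
  imports Defs "Jordan_Normal_Form.Char_Poly"
begin

text \<open>Let \<open>A i j = 2 (u i, u j)\<close>. The products of reflections act on coefficient vectors by
  integer polynomials in the entries of \<open>A\<close>. Torsion of \<open>\<gamma> i \<gamma> j\<close> gives
  \<open>A i j = \<mu> + 1/\<mu>\<close> for a root of unity \<open>\<mu>\<close>, so \<open>A\<close> has entries in \<open>\<int>[\<zeta>]\<close>, and the torsion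
  relations persist when \<open>\<zeta>\<close> is replaced by a conjugate \<open>\<tau>\<close>, where \<open>A\<close> becomes a real matrix.

  This real matrix is positive semidefinite: in a minimal counterexample the form is
  Lorentzian, every reflection preserves the cone of negative vectors, and averaging over the
  powers of the product \<open>C\<close> of all reflections, which has finite order, yields a negative
  vector fixed by \<open>C\<close>. But the fixed vectors of \<open>C\<close> lie in the radical.

  By Cauchy-Schwarz all conjugates of the elements \<open>2 (g u\<^sub>j, u\<^sub>k)\<close> of \<open>\<int>[\<zeta>]\<close> are bounded by
  2, so there are only finitely many of them. Semisimplicity makes the form nondegenerate on the
  span of the \<open>u i\<close>, and then these numbers determine \<open>g\<close>.\<close>

subsection \<open>Products of reflections and the positivity of the Gram form\<close>

definition gram_row :: "('i \<Rightarrow> 'i \<Rightarrow> 'a::comm_ring_1) \<Rightarrow> 'i set \<Rightarrow> ('i \<Rightarrow> 'a) \<Rightarrow> 'i \<Rightarrow> 'a" where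
  "gram_row A I x i = (\<Sum>j\<in>I. A i j * x j)"

definition gram_form :: "('i \<Rightarrow> 'i \<Rightarrow> 'a::comm_ring_1) \<Rightarrow> 'i set \<Rightarrow> ('i \<Rightarrow> 'a) \<Rightarrow> ('i \<Rightarrow> 'a) \<Rightarrow> 'a" where
  "gram_form A I x y = (\<Sum>i\<in>I. x i * gram_row A I y i)"

text \<open>The reflection in the \<open>i\<close>-th basis vector for a form with
  \<open>A i i = 2\<close>. For \<open>A i j = 2 (u i, u j)\<close> it subtracts
  \<open>2 (v, u i)\<close> from the coefficient of \<open>u i\<close>, where \<open>v\<close> is
  the combination of the \<open>u j\<close> with coefficients \<open>x\<close>. Coefficients come
  from any commutative ring, so that one word can be read over integer polynomials, complex numbers
  and reals.\<close>

definition reflect :: "('i \<Rightarrow> 'i \<Rightarrow> 'a::comm_ring_1) \<Rightarrow> 'i set \<Rightarrow> 'i \<Rightarrow> ('i \<Rightarrow> 'a) \<Rightarrow> 'i \<Rightarrow> 'a" where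
  "reflect A I i x = x(i := x i - gram_row A I x i)"

abbreviation reflects :: "('i \<Rightarrow> 'i \<Rightarrow> 'a::comm_ring_1) \<Rightarrow> 'i set \<Rightarrow> 'i list \<Rightarrow> ('i \<Rightarrow> 'a) \<Rightarrow> 'i \<Rightarrow> 'a" where
  "reflects A I is \<equiv> foldr (reflect A I) is"

definition basis_fun :: "'i \<Rightarrow> 'i \<Rightarrow> 'a::zero_neq_one" where
  "basis_fun i j = (if j = i then 1 else 0)"

lemma reflect_outside: "j \<noteq> i \<Longrightarrow> reflect A I i x j = x j"
  by (simp add: reflect_def)

lemma reflects_outside: "j \<notin> set is \<Longrightarrow> reflects A I is x j = x j"
  by (induction "is") (auto simp: reflect_outside)

lemma gram_row_add: "gram_row A I (\<lambda>j. x j + y j) i = gram_row A I x i + gram_row A I y i"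
  by (simp add: gram_row_def algebra_simps sum.distrib)

lemma gram_row_scale: "gram_row A I (\<lambda>j. c * x j) i = c * gram_row A I x i"
  by (simp add: gram_row_def sum_distrib_left mult.left_commute)

lemma gram_row_diff: "gram_row A I (\<lambda>j. x j - y j) i = gram_row A I x i - gram_row A I y i"
  by (simp add: gram_row_def algebra_simps sum_subtractf)

lemma gram_row_zero: "gram_row A I (\<lambda>j. 0) i = 0"
  by (simp add: gram_row_def)

lemma gram_row_basis:
  assumes "finite I" "k \<in> I"
  shows "gram_row A I (basis_fun k) i = A i k"
  using assms by (simp add: gram_row_def basis_fun_def if_distrib cong: if_cong)

lemma reflect_add: "reflect A I i (\<lambda>j. x j + y j) = (\<lambda>j. reflect A I i x j + reflect A I i y j)"
  by (auto simp: reflect_def gram_row_add fun_eq_iff)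

lemma reflect_scale: "reflect A I i (\<lambda>j. c * x j) = (\<lambda>j. c * reflect A I i x j)"
  by (auto simp: reflect_def gram_row_scale fun_eq_iff algebra_simps)

lemma reflects_add:
  "reflects A I is (\<lambda>j. x j + y j) = (\<lambda>j. reflects A I is x j + reflects A I is y j)"
  by (induction "is") (simp_all add: reflect_add)

lemma reflects_scale:
  "reflects A I is (\<lambda>j. c * x j) = (\<lambda>j. c * reflects A I is x j)"
  by (induction "is") (simp_all add: reflect_scale)

lemma reflects_zero: "reflects A I is (\<lambda>j. 0) = (\<lambda>j. 0)"
  using reflects_scale[of A I "is" 0 "\<lambda>j. 0"] by simp

lemma reflects_sum:
  "reflects A I is (\<lambda>j. \<Sum>k\<in>K. x k j) = (\<lambda>j. \<Sum>k\<in>K. reflects A I is (x k) j)"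
  by (induction K rule: infinite_finite_induct) (simp_all add: reflects_zero reflects_add)

lemma funpow_reflects_sum:
  "(reflects A I is ^^ n) (\<lambda>j. \<Sum>k\<in>K. x k j) = (\<lambda>j. \<Sum>k\<in>K. (reflects A I is ^^ n) (x k) j)"
  by (induction n) (simp_all add: reflects_sum)

lemma funpow_reflects_scale:
  "(reflects A I is ^^ n) (\<lambda>j. c * x j) = (\<lambda>j. c * (reflects A I is ^^ n) x j)"
  by (induction n) (simp_all add: reflects_scale)

lemma gram_form_add_left: "gram_form A I (\<lambda>j. x j + y j) z = gram_form A I x z + gram_form A I y z"
  by (simp add: gram_form_def algebra_simps sum.distrib)

lemma gram_form_scale_left: "gram_form A I (\<lambda>j. c * x j) z = c * gram_form A I x z"
  by (simp add: gram_form_def sum_distrib_left mult.assoc)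

lemma gram_form_diff_left: "gram_form A I (\<lambda>j. x j - y j) z = gram_form A I x z - gram_form A I y z"
  by (simp add: gram_form_def algebra_simps sum_subtractf)

lemma gram_form_basis:
  assumes "finite I" "k \<in> I"
  shows "gram_form A I (basis_fun k) x = gram_row A I x k"
proof -
  have "gram_form A I (basis_fun k) x = (\<Sum>i\<in>I. if i = k then gram_row A I x i else 0)"
    unfolding gram_form_def basis_fun_def by (rule sum.cong) auto
  then show ?thesis using assms by simp
qed

locale symmetric_gram =
  fixes A :: "'i \<Rightarrow> 'i \<Rightarrow> 'a::comm_ring_1" and I :: "'i set"
  assumes finite_I: "finite I"
    and sym: "\<lbrakk>i \<in> I; j \<in> I\<rbrakk> \<Longrightarrow> A i j = A j i"
    and diag: "i \<in> I \<Longrightarrow> A i i = 2"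
begin

lemma gram_form_commute: "gram_form A I x y = gram_form A I y x"
proof -
  have "gram_form A I x y = (\<Sum>i\<in>I. \<Sum>j\<in>I. x i * (A i j * y j))"
    by (simp add: gram_form_def gram_row_def sum_distrib_left)
  also have "\<dots> = (\<Sum>j\<in>I. \<Sum>i\<in>I. x i * (A i j * y j))"
    by (rule sum.swap)
  also have "\<dots> = (\<Sum>j\<in>I. \<Sum>i\<in>I. y j * (A j i * x i))"
    by (intro sum.cong refl) (simp add: sym mult.commute mult.left_commute)
  finally show ?thesis by (simp add: gram_form_def gram_row_def sum_distrib_left)
qed

lemma gram_form_add_right: "gram_form A I z (\<lambda>j. x j + y j) = gram_form A I z x + gram_form A I z y"
  by (metis gram_form_add_left gram_form_commute)

lemma gram_form_diff_right: "gram_form A I z (\<lambda>j. x j - y j) = gram_form A I z x - gram_form A I z y"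
  by (metis gram_form_diff_left gram_form_commute)

lemma gram_form_scale_right: "gram_form A I z (\<lambda>j. c * x j) = c * gram_form A I z x"
  by (metis gram_form_scale_left gram_form_commute)

lemmas gram_form_bilinear =
  gram_form_add_left gram_form_diff_left gram_form_scale_left
  gram_form_add_right gram_form_diff_right gram_form_scale_right

lemma reflect_eq_diff: "reflect A I i x = (\<lambda>j. x j - gram_row A I x i * basis_fun i j)"
  by (auto simp: reflect_def basis_fun_def)

lemma gram_form_reflect_right:
  assumes "i \<in> I"
  shows "gram_form A I x (reflect A I i y) = gram_form A I x y - gram_row A I x i * gram_row A I y i"
  using assms finite_I
  by (simp add: reflect_eq_diff gram_form_bilinear gram_form_basis gram_form_commute[of x "basis_fun i"])

lemma gram_form_reflect:
  assumes "i \<in> I"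
  shows "gram_form A I (reflect A I i x) (reflect A I i y) = gram_form A I x y"
proof -
  have row: "gram_row A I (reflect A I i x) i = - gram_row A I x i"
    using assms finite_I by (simp add: reflect_eq_diff gram_row_diff gram_row_scale gram_row_basis diag)
  have "gram_form A I (reflect A I i x) (reflect A I i y)
      = gram_form A I y (reflect A I i x) + gram_row A I x i * gram_row A I y i"
    using assms by (simp add: gram_form_reflect_right row gram_form_commute[of _ y])
  then show ?thesis
    using assms by (simp add: gram_form_reflect_right gram_form_commute[of y x])
qed

lemma gram_form_reflects:
  assumes "set is \<subseteq> I"
  shows "gram_form A I (reflects A I is x) (reflects A I is y) = gram_form A I x y"
  using assms by (induction "is") (auto simp: gram_form_reflect)

end

text \<open>In a word without repetitions each coordinate is changed by one reflection only. The
  outermost reflection changes just coordinate \<open>k\<close>, which the inner word leaves alone;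
  so if the whole word fixes \<open>x\<close>, the inner word and the reflection \<open>k\<close>
  both do.\<close>

lemma gram_row_eq_0_if_reflects_fix:
  assumes "distinct is" "reflects A I is x = x" "i \<in> set is"
  shows "gram_row A I x i = 0"
  using assms
proof (induction "is")
  case (Cons k "is")
  have *: "reflect A I k (reflects A I is x) = x" using Cons.prems(2) by simp
  have y: "reflects A I is x = x"
  proof
    fix j
    show "reflects A I is x j = x j"
    proof (cases "j = k")
      case True
      then show ?thesis using Cons.prems(1) by (simp add: reflects_outside)
    next
      case False
      then show ?thesis using fun_cong[OF *, of j] by (simp add: reflect_def)
    qed
  qed
  have "gram_row A I x k = 0"
    using fun_cong[OF *, of k] unfolding y by (simp add: reflect_def)
  then show ?case using Cons y by auto
qed simp

section \<open>Positive semidefiniteness from torsion of ordered products\<close>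

definition psd_on :: "('i \<Rightarrow> 'i \<Rightarrow> real) \<Rightarrow> 'i set \<Rightarrow> 'i set \<Rightarrow> bool" where
  "psd_on A I K \<longleftrightarrow> (\<forall>x. (\<forall>i. i \<notin> K \<longrightarrow> x i = 0) \<longrightarrow> gram_form A I x x \<ge> 0)"

lemma gram_form_eq_0_if_kernel:
  assumes "\<And>i. i \<notin> K \<Longrightarrow> x i = 0" "\<And>i. i \<in> K \<Longrightarrow> gram_row A I z i = 0"
  shows "gram_form A I x z = 0"
  unfolding gram_form_def by (rule sum.neutral) (metis assms mult_zero_left mult_zero_right)

text \<open>Torsion is assumed only modulo the kernel of the rows in \<open>K\<close>, since a
  relation between vectors determines their coefficients only up to such an ambiguity. Induction on
  \<open>K\<close> makes every proper subset positive semidefinite; a negative vector on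
  \<open>K\<close> then leaves a single negative direction, and a negative vector fixed by the
  product gives the contradiction.\<close>

lemma psd_if_ordered_products_torsion:
  fixes A :: "'i \<Rightarrow> 'i \<Rightarrow> real"
  assumes "symmetric_gram A I"
    and torsion: "\<And>K. K \<subseteq> I \<Longrightarrow> \<exists>is N. distinct is \<and> set is = K \<and> N > 0 \<and>
      (\<forall>x. (\<forall>i. i \<notin> K \<longrightarrow> x i = 0) \<longrightarrow>
        (\<forall>k\<in>K. gram_row A I (\<lambda>j. (reflects A I is ^^ N) x j - x j) k = 0))"
    and "K \<subseteq> I"
  shows "psd_on A I K"
proof -
  interpret symmetric_gram A I by fact
  let ?b = "gram_form A I"
  have "finite K" using \<open>K \<subseteq> I\<close> finite_I finite_subset by blast
  then show ?thesis using \<open>K \<subseteq> I\<close>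
  proof (induction K rule: finite_psubset_induct)
    case (psubset K)
    define S where "S = {x::'i \<Rightarrow> real. \<forall>i. i \<notin> K \<longrightarrow> x i = 0}"
    have psd_hyper: "?b x x \<ge> 0" if "x \<in> S" "k \<in> K" "x k = 0" for x k
    proof -
      have "psd_on A I (K - {k})"
        using psubset that(2) by (metis Diff_subset Diff_iff insertI1 psubsetI subset_trans)
      then show ?thesis using that unfolding psd_on_def S_def by auto
    qed
    show ?case
    proof (rule ccontr)
      assume "\<not> psd_on A I K"
      then obtain w0 where w0: "w0 \<in> S" "?b w0 w0 < 0"
        unfolding psd_on_def S_def by (auto simp: not_le)
      obtain r where r: "r \<in> K"
      proof (cases "K = {}")
        case True
        then have "w0 = (\<lambda>j. 0 * w0 j)" using w0(1) by (auto simp: S_def)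
        then have "?b w0 w0 = 0" by (metis gram_form_scale_left mult_zero_left)
        then show ?thesis using w0 by simp
      qed blast
      \<comment> \<open>Subtracting a multiple of a kernel vector from \<open>w0\<close> kills a
        coordinate without changing the form value, which contradicts \<open>psd_hyper\<close>. So
        the form is nondegenerate on vectors supported on \<open>K\<close>.\<close>
      have kernel: "z = (\<lambda>_. 0)" if z: "z \<in> S" "\<And>k. k \<in> K \<Longrightarrow> gram_row A I z k = 0" for z
      proof (rule ccontr)
        assume "z \<noteq> (\<lambda>_. 0)"
        then obtain k where "z k \<noteq> 0" by auto
        then have "k \<in> K" using z by (auto simp: S_def)
        define c where "c = w0 k / z k"
        define w' where "w' = (\<lambda>j. w0 j - c * z j)"
        have b0: "?b x z = 0" if "x \<in> S" for x
          using that z(2) gram_form_eq_0_if_kernel[of K x A I z] by (auto simp: S_def)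
        have "w' \<in> S" "w' k = 0"
          using w0 z \<open>z k \<noteq> 0\<close> by (auto simp: w'_def S_def c_def)
        moreover have "?b w' w' = ?b w0 w0"
          unfolding w'_def using b0 w0 z(1) by (simp add: gram_form_bilinear gram_form_commute[of z w0])
        ultimately show False using psd_hyper[of w' k] \<open>k \<in> K\<close> w0 by simp
      qed
      \<comment> \<open>One half of the cone of negative vectors. The sign of coordinate
        \<open>r\<close> separates the halves because that coordinate never vanishes on a negative
        vector.\<close>
      define P where "P = {v \<in> S. ?b v v < 0 \<and> v r > 0}"
      have P_neg: "?b v w < 0" if v: "v \<in> P" and w: "w \<in> P" for v w
      proof (rule ccontr)
        assume "\<not> ?b v w < 0"
        then have ge: "?b v w \<ge> 0" by simp
        \<comment> \<open>This combination has coordinate \<open>r\<close> equal to 0, hence a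
          nonnegative form value; expanding it gives a negative value if \<open>?b v w\<close> is
          nonnegative.\<close>
        define x where "x = (\<lambda>j. v r * w j - w r * v j)"
        have "x \<in> S" "x r = 0" using v w by (auto simp: x_def P_def S_def)
        then have "?b x x \<ge> 0" using psd_hyper r by blast
        moreover have "?b x x = (v r)\<^sup>2 * ?b w w + (w r)\<^sup>2 * ?b v v - 2 * (v r * w r) * ?b v w"
          unfolding x_def
          by (simp add: gram_form_bilinear gram_form_commute[of w v] power2_eq_square)
            (simp add: algebra_simps)
        moreover have "(v r)\<^sup>2 * ?b w w < 0" "(w r)\<^sup>2 * ?b v v < 0" "(v r * w r) * ?b v w \<ge> 0"
          using v w ge by (auto simp: P_def mult_pos_neg)
        ultimately show False by linarith
      qed
      have P_add: "(\<lambda>j. v j + w j) \<in> P" if v: "v \<in> P" and w: "w \<in> P" for v w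
        using v w P_neg[OF v w] by (auto simp: P_def S_def gram_form_bilinear gram_form_commute[of w v])
      have P_cases: "v \<in> P \<or> (\<lambda>j. - 1 * v j) \<in> P" if v: "v \<in> S" "?b v v < 0" for v
      proof -
        have "v r \<noteq> 0" using psd_hyper[OF v(1) r] v by auto
        moreover have "?b (\<lambda>j. - 1 * v j) (\<lambda>j. - 1 * v j) = ?b v v"
          using gram_form_scale_left[of A I "- 1" v "\<lambda>j. - 1 * v j"] gram_form_scale_right[of v "- 1" v] by simp
        ultimately show ?thesis using v unfolding P_def S_def by auto
      qed
      \<comment> \<open>The value \<open>?b v (reflect A I i v)\<close> equals \<open>?b v v\<close>
        minus a square, hence is negative. If the image were in the opposite half,
        \<open>P_neg\<close> would make this value positive.\<close>
      have P_reflect: "reflect A I i v \<in> P" if i: "i \<in> K" and v: "v \<in> P" for i v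
      proof -
        have iI: "i \<in> I" using i psubset.prems by auto
        have "reflect A I i v \<in> S" using v i by (auto simp: P_def S_def reflect_def)
        moreover have "?b (reflect A I i v) (reflect A I i v) < 0"
          using v iI by (simp add: gram_form_reflect P_def)
        moreover have neg: "?b v (reflect A I i v) < 0"
          using v gram_form_reflect_right[OF iI, of v v] zero_le_square[of "gram_row A I v i"]
          unfolding P_def mem_Collect_eq by linarith
        moreover have "(\<lambda>j. - 1 * reflect A I i v j) \<notin> P"
        proof
          assume "(\<lambda>j. - 1 * reflect A I i v j) \<in> P"
          from P_neg[OF v this] gram_form_scale_right[of v "- 1" "reflect A I i v"] neg
          show False by linarith
        qed
        ultimately show ?thesis using P_cases[of "reflect A I i v"] by blast
      qed
      obtain w where w: "w \<in> P" using P_cases[OF w0] by blast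
      obtain "is" N where wd: "distinct is" "set is = K" "N > 0" and
        tor: "\<And>x. x \<in> S \<Longrightarrow> \<forall>k\<in>K. gram_row A I (\<lambda>j. (reflects A I is ^^ N) x j - x j) k = 0"
        using torsion[OF psubset.prems] unfolding S_def by auto
      define C where "C = reflects A I is"
      have "reflects A I js v \<in> P" if "set js \<subseteq> K" "v \<in> P" for js v
        using that by (induction js) (auto intro: P_reflect)
      then have P_C: "C v \<in> P" if "v \<in> P" for v
        unfolding C_def using that wd by auto
      have P_pow: "(C ^^ k) w \<in> P" for k
        by (induction k) (auto intro: P_C w)
      \<comment> \<open>The hypothesis gives this up to a kernel vector, and \<open>kernel\<close>
        shows that such a vector is zero.\<close>
      have CNw: "(C ^^ N) w = w"
      proof -
        have "w \<in> S" using w by (simp add: P_def)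
        have "(\<lambda>j. (C ^^ N) w j - w j) = (\<lambda>_. 0)"
        proof (rule kernel)
          show "(\<lambda>j. (C ^^ N) w j - w j) \<in> S" using \<open>w \<in> S\<close> P_pow[of N] by (auto simp: S_def P_def)
          show "gram_row A I (\<lambda>j. (C ^^ N) w j - w j) k = 0" if "k \<in> K" for k
            using tor[OF \<open>w \<in> S\<close>] that by (simp add: C_def)
        qed
        then show ?thesis by (simp add: fun_eq_iff)
      qed
      \<comment> \<open>Sums along the orbit of \<open>w\<close>: they stay in \<open>P\<close>,
        which is closed under addition, and the sum over \<open>N\<close> steps is fixed by
        \<open>C\<close>.\<close>
      define s where "s n = (\<lambda>j. \<Sum>k<n. (C ^^ k) w j)" for n
      have "s (Suc n) \<in> P" for n
      proof (induction n)
        case 0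
        then show ?case using w by (simp add: s_def)
      next
        case (Suc n)
        then show ?case using P_add[OF Suc P_pow[of "Suc n"]] by (simp add: s_def)
      qed
      then have sP: "s N \<in> P" using wd(3) by (metis Suc_pred)
      have "C (s N) = (\<lambda>j. \<Sum>k<N. (C ^^ Suc k) w j)"
        unfolding s_def C_def by (simp add: reflects_sum)
      also have "\<dots> = (\<lambda>j. s (Suc N) j - w j)"
        unfolding s_def by (subst sum.lessThan_Suc_shift) simp
      also have "\<dots> = s N" using CNw by (simp add: s_def)
      \<comment> \<open>A vector fixed by a product of distinct reflections lies in the kernel of
        their rows, so its form value is 0 and not negative.\<close>
      finally have "gram_row A I (s N) k = 0" if "k \<in> K" for k
        using gram_row_eq_0_if_reflects_fix[of "is" A I "s N" k] that wd by (simp add: C_def)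
      then have "?b (s N) (s N) = 0"
        using gram_form_eq_0_if_kernel[of K "s N" A I "s N"] sP by (auto simp: P_def S_def)
      then show False using sP by (simp add: P_def)
    qed
  qed
qed

text \<open>Cauchy-Schwarz: the row is the value of the form at \<open>e\<close> and
  \<open>x\<close>, both of which have form value 2 because reflections are isometries. Testing
  positivity on \<open>x + e\<close> and \<open>x - e\<close> is enough.\<close>

lemma psd_row_bound:
  fixes A :: "'i \<Rightarrow> 'i \<Rightarrow> real"
  assumes "symmetric_gram A I" "psd_on A I I" "set is \<subseteq> I" "j \<in> I" "k \<in> I"
  shows "\<bar>gram_row A I (reflects A I is (basis_fun j)) k\<bar> \<le> 2"
proof -
  interpret symmetric_gram A I by fact
  let ?b = "gram_form A I"
  define x where "x = reflects A I is (basis_fun j)"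
  define e where "e = (basis_fun k :: 'i \<Rightarrow> real)"
  have ee: "?b e e = 2" using assms finite_I by (simp add: e_def gram_form_basis gram_row_basis diag)
  have xx: "?b x x = 2" using assms finite_I
    by (simp add: x_def gram_form_reflects gram_form_basis gram_row_basis diag)
  have supp: "x i = 0" "e i = 0" if "i \<notin> I" for i
  proof -
    have "i \<notin> set is" "i \<noteq> j" "i \<noteq> k" using that assms by auto
    then show "x i = 0" "e i = 0"
      by (auto simp: x_def e_def reflects_outside) (simp_all add: basis_fun_def)
  qed
  have "?b (\<lambda>i. x i + c * e i) (\<lambda>i. x i + c * e i) \<ge> 0" for c
    using assms(2) supp unfolding psd_on_def by simp
  then have "2 + 2 * c * ?b e x + 2 * c\<^sup>2 \<ge> 0" for c
    by (simp add: gram_form_bilinear gram_form_commute[of x e] ee xx power2_eq_square algebra_simps)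
  from this[of 1] this[of "-1"] have "\<bar>?b e x\<bar> \<le> 2" by auto
  then show ?thesis using assms finite_I by (simp add: e_def x_def gram_form_basis)
qed

subsection \<open>Conjugates of integer polynomials at a root of unity\<close>

abbreviation int_eval :: "int poly \<Rightarrow> complex \<Rightarrow> complex" where
  "int_eval p z \<equiv> poly (map_poly of_int p) z"

lemma int_eval_zero_if_dvd_smult:
  assumes "Polynomial.smult c p = f * q" "c \<noteq> 0" "int_eval f z = 0"
  shows "int_eval p z = 0"
proof -
  have "of_int c * int_eval p z = int_eval (Polynomial.smult c p) z" by (simp add: hom_distribs)
  also have "\<dots> = int_eval f z * int_eval q z" unfolding assms(1) by (simp add: hom_distribs)
  finally show ?thesis using assms by simp
qed

text \<open>Minimality refers to the degree alone, so the leading coefficient is an arbitrary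
  nonzero integer and division by \<open>f\<close> works up to an integer factor. The complex roots
  of \<open>f\<close> serve as the conjugates of \<open>z\<close>.\<close>

definition min_int_poly_of :: "complex \<Rightarrow> int poly \<Rightarrow> bool" where
  "min_int_poly_of z f \<longleftrightarrow> f \<noteq> 0 \<and> int_eval f z = 0 \<and>
     (\<forall>g. int_eval g z = 0 \<longrightarrow> g = 0 \<or> degree f \<le> degree g)"

lemma min_int_poly_of_exists:
  assumes "p \<noteq> 0" "int_eval p z = 0"
  obtains f where "min_int_poly_of z f"
proof -
  obtain f where "f \<noteq> 0 \<and> int_eval f z = 0"
    "\<And>g. g \<noteq> 0 \<and> int_eval g z = 0 \<Longrightarrow> degree f \<le> degree g"
    using ex_has_least_nat[of "\<lambda>g. g \<noteq> 0 \<and> int_eval g z = 0" p degree] assms by blast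
  then show ?thesis using that unfolding min_int_poly_of_def by blast
qed

text \<open>The pseudo-remainder of \<open>h\<close> by \<open>f\<close> also vanishes at
  \<open>z\<close> and has smaller degree, so minimality forces it to be 0.\<close>

lemma min_int_poly_divides:
  assumes f: "min_int_poly_of z f" and "int_eval h z = 0"
  obtains c q where "c \<noteq> 0" "Polynomial.smult c h = f * q"
proof -
  have "f \<noteq> 0" using f by (simp add: min_int_poly_of_def)
  define r where "r = pseudo_mod h f"
  obtain c q where c: "c \<noteq> 0" "Polynomial.smult c h = f * q + r"
    and deg: "r = 0 \<or> degree r < degree f"
    using pseudo_mod[OF \<open>f \<noteq> 0\<close>, of h] unfolding r_def by blast
  have "int_eval (Polynomial.smult c h) z = int_eval (f * q + r) z" using c by simp
  then have "int_eval r z = 0"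
    using assms by (simp add: hom_distribs min_int_poly_of_def)
  then have "r = 0" using f deg unfolding min_int_poly_of_def by (metis not_le)
  then show ?thesis using that c by simp
qed

text \<open>The transfer principle that replaces Galois automorphisms: integer polynomial relations
  at \<open>z\<close> pass to every conjugate.\<close>

lemma conjugate_root:
  assumes "min_int_poly_of z f" "int_eval h z = 0" "int_eval f t = 0"
  shows "int_eval h t = 0"
  using min_int_poly_divides[OF assms(1,2)] int_eval_zero_if_dvd_smult[OF _ _ assms(3)] by metis

lemma conjugate_root_of_unity:
  assumes f: "min_int_poly_of z f" and "z ^ M = 1" "int_eval f t = 0"
  shows "t ^ M = 1"
proof -
  have *: "int_eval (monom 1 M - 1) x = x ^ M - 1" for x
    by (simp add: hom_distribs poly_monom)
  show ?thesis using conjugate_root[OF f, of "monom 1 M - 1" t] assms by (simp add: *)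
qed

text \<open>Up to an integer factor \<open>f\<close> divides \<open>X^M - 1\<close>, so a double
  root of \<open>f\<close> would be a root of \<open>M X^(M-1)\<close>, hence 0, which is no root of
  unity. Having as many conjugates as the degree makes interpolation at them possible.\<close>

lemma card_conjugates:
  assumes f: "min_int_poly_of z f" and "z ^ M = 1" "M > 0"
  shows "finite {t. int_eval f t = 0}" "card {t. int_eval f t = 0} = degree f"
proof -
  define fc where "fc = (map_poly of_int f :: complex poly)"
  have "f \<noteq> 0" using f by (simp add: min_int_poly_of_def)
  then have "fc \<noteq> 0" by (simp add: fc_def)
  define u where "u = (monom 1 M - 1 :: int poly)"
  have "int_eval u z = 0" using assms by (simp add: u_def hom_distribs poly_monom)
  then obtain c q where c: "c \<noteq> 0" "Polynomial.smult c u = f * q" using min_int_poly_divides[OF f] by blast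
  define qc where "qc = (map_poly of_int q :: complex poly)"
  have eq: "Polynomial.smult (of_int c) (monom 1 M - 1) = fc * qc"
  proof -
    have "map_poly of_int (Polynomial.smult c u) = (map_poly of_int (f * q) :: complex poly)" using c by simp
    then show ?thesis by (simp add: u_def fc_def qc_def hom_distribs)
  qed
  have "rsquarefree fc"
    unfolding rsquarefree_roots
  proof (intro allI notI)
    fix a assume a: "poly fc a = 0 \<and> poly (pderiv fc) a = 0"
    have "poly (pderiv (Polynomial.smult (of_int c) (monom 1 M - 1))) a = 0"
      unfolding eq using a by (simp add: pderiv_mult)
    then have "of_int c * (of_nat M * a ^ (M - 1)) = 0"
      by (simp add: pderiv_smult pderiv_diff pderiv_monom poly_monom)
    then have "a ^ (M - 1) = 0" using c assms by simp
    then have "a = 0" by simp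
    moreover have "a ^ M = 1"
      using conjugate_root_of_unity[OF f assms(2)] a by (simp add: fc_def)
    ultimately show False using assms by (simp add: power_0_left)
  qed
  then have "fc = Polynomial.smult (lead_coeff fc) (\<Prod>z|poly fc z = 0. [:-z, 1:])"
    using complex_poly_decompose_rsquarefree by metis
  moreover have fin: "finite {z. poly fc z = 0}" using \<open>fc \<noteq> 0\<close> poly_roots_finite by blast
  moreover have "degree (\<Prod>z|poly fc z = 0. [:-z, 1:]) = card {z. poly fc z = 0}"
    by (subst degree_prod_eq_sum_degree) auto
  ultimately have "degree fc = card {z. poly fc z = 0}"
    using \<open>fc \<noteq> 0\<close> by (metis degree_smult_eq leading_coeff_0_iff)
  then show "finite {t. int_eval f t = 0}" "card {t. int_eval f t = 0} = degree f"
    using fin by (simp_all add: fc_def)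
qed

section \<open>Finiteness of integer polynomial values bounded at all conjugates\<close>

definition lagrange_basis :: "complex set \<Rightarrow> complex \<Rightarrow> complex poly" where
  "lagrange_basis S s = (\<Prod>t\<in>S - {s}. Polynomial.smult (1 / (s - t)) [:-t, 1:])"

lemma lagrange_interpolation:
  assumes "finite S" "degree p < card S"
  shows "p = (\<Sum>s\<in>S. Polynomial.smult (poly p s) (lagrange_basis S s))"
proof (rule poly_eqI_degree[of S])
  have eval: "poly (lagrange_basis S s) x = (if x = s then 1 else 0)" if "s \<in> S" "x \<in> S" for s x
  proof -
    have "poly (lagrange_basis S s) x = (\<Prod>t\<in>S - {s}. (x - t) / (s - t))"
      unfolding lagrange_basis_def poly_prod by (intro prod.cong) (simp_all add: diff_divide_distrib)
    also have "\<dots> = (if x = s then 1 else 0)"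
    proof (cases "x = s")
      case False
      then show ?thesis using assms that by (auto intro!: prod_zero)
    next
      case True
      then show ?thesis by (auto intro!: prod.neutral split: if_splits)
    qed
    finally show ?thesis .
  qed
  show "poly p x = poly (\<Sum>s\<in>S. Polynomial.smult (poly p s) (lagrange_basis S s)) x" if "x \<in> S" for x
  proof -
    have "poly (\<Sum>s\<in>S. Polynomial.smult (poly p s) (lagrange_basis S s)) x
        = (\<Sum>s\<in>S. if s = x then poly p x else 0)"
      using that unfolding poly_sum by (intro sum.cong) (auto simp: eval)
    then show ?thesis using that assms by simp
  qed
  have "degree (lagrange_basis S s) \<le> card S - 1" if "s \<in> S" for s
  proof -
    have "degree (lagrange_basis S s) \<le> (\<Sum>t\<in>S - {s}. degree (Polynomial.smult (1 / (s - t)) [:-t, 1:]))"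
      unfolding lagrange_basis_def
      using degree_prod_sum_le[of "S - {s}" "\<lambda>t. Polynomial.smult (1 / (s - t)) [:-t, 1:]"] assms(1)
      unfolding o_def by blast
    also have "\<dots> \<le> (\<Sum>t\<in>S - {s}. 1)" by (intro sum_mono) simp
    also have "\<dots> = card S - 1" using that by simp
    finally show ?thesis .
  qed
  then have "degree (\<Sum>s\<in>S. Polynomial.smult (poly p s) (lagrange_basis S s)) \<le> card S - 1"
    by (intro degree_sum_le assms) (meson degree_smult_le le_trans)
  then show "degree (\<Sum>s\<in>S. Polynomial.smult (poly p s) (lagrange_basis S s)) < card S" using assms by simp
qed (use assms in simp)

lemma finite_int_polys_bounded_coeff:
  "finite {p :: int poly. degree p < d \<and> (\<forall>i. \<bar>coeff p i\<bar> \<le> B)}"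
proof (rule finite_subset)
  show "{p :: int poly. degree p < d \<and> (\<forall>i. \<bar>coeff p i\<bar> \<le> B)}
      \<subseteq> Poly ` {xs. set xs \<subseteq> {-B..B} \<and> length xs = d}"
  proof
    fix p :: "int poly" assume p: "p \<in> {p. degree p < d \<and> (\<forall>i. \<bar>coeff p i\<bar> \<le> B)}"
    have "p = Poly (map (coeff p) [0..<d])"
      using p by (intro poly_eqI) (auto simp: coeff_Poly_eq nth_default_def coeff_eq_0)
    moreover have "set (map (coeff p) [0..<d]) \<subseteq> {-B..B}" using p by (auto simp: abs_le_iff minus_le_iff)
    ultimately show "p \<in> Poly ` {xs. set xs \<subseteq> {-B..B} \<and> length xs = d}" by fastforce
  qed
  show "finite (Poly ` {xs. set xs \<subseteq> {-B..B::int} \<and> length xs = d})"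
    by (intro finite_imageI finite_lists_length_eq) simp
qed

text \<open>By interpolation the coefficients are fixed linear combinations of the values on
  \<open>S\<close>, so bounded values force bounded integer coefficients.\<close>

lemma finite_int_polys_bounded_at_conjugates:
  assumes "finite S"
  shows "finite {p :: int poly. degree p < card S \<and> (\<forall>t\<in>S. cmod (int_eval p t) \<le> B)}"
proof -
  \<comment> \<open>The bound that interpolation gives for coefficient \<open>i\<close>;
    \<open>\<bar>B\<bar>\<close> keeps it nonnegative for every \<open>B\<close>. Summing over
    \<open>i\<close> then yields one bound \<open>D\<close> for all coefficients.\<close>
  define c where "c i = (\<Sum>s\<in>S. \<bar>B\<bar> * cmod (coeff (lagrange_basis S s) i))" for i
  define D where "D = \<lceil>\<Sum>i<card S. c i\<rceil>"
  have c0: "c i \<ge> 0" for i unfolding c_def by (intro sum_nonneg) simp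
  show ?thesis
  proof (rule finite_subset[OF _ finite_int_polys_bounded_coeff[of "card S" D]], safe)
    fix p :: "int poly" and i
    assume deg: "degree p < card S" and b: "\<forall>t\<in>S. cmod (int_eval p t) \<le> B"
    have D0: "D \<ge> 0" using c0 unfolding D_def by (simp add: sum_nonneg order_less_le_trans[of "-1" 0])
    show "\<bar>coeff p i\<bar> \<le> D"
    proof (cases "i < card S")
      case False
      then show ?thesis using deg D0 by (simp add: coeff_eq_0)
    next
      case True
      have "map_poly of_int p = (\<Sum>s\<in>S. Polynomial.smult (int_eval p s) (lagrange_basis S s))"
        using assms deg by (intro lagrange_interpolation) auto
      then have "of_int (coeff p i) = (\<Sum>s\<in>S. int_eval p s * coeff (lagrange_basis S s) i)"
        by (metis (no_types, lifting) coeff_map_poly coeff_smult coeff_sum of_int_0 sum.cong)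
      then have "cmod (of_int (coeff p i)) \<le> (\<Sum>s\<in>S. cmod (int_eval p s * coeff (lagrange_basis S s) i))"
        by (simp add: norm_sum)
      also have "\<dots> \<le> c i"
        unfolding c_def norm_mult using b by (intro sum_mono mult_right_mono) (auto intro: order_trans)
      also have "c i \<le> (\<Sum>i<card S. c i)" using c0 True by (intro member_le_sum) auto
      also have "\<dots> \<le> of_int D" by (simp add: D_def)
      finally show ?thesis by (simp flip: of_int_abs)
    qed
  qed
qed

text \<open>Reducing modulo \<open>X^M - 1\<close> before the pseudo-division by \<open>f\<close> makes the multiplier
  independent of \<open>p\<close>.\<close>

lemma conjugate_values_reduced:
  assumes f: "min_int_poly_of z f" and M: "z ^ M = 1" "M > 0"
  obtains g where "g = 0 \<or> degree g < degree f"
    and "\<And>t. int_eval f t = 0 \<Longrightarrow> int_eval g t = of_int (lead_coeff f ^ M) * int_eval p t"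
proof -
  define u where "u = (monom 1 M - 1 :: int poly)"
  have deg_u: "degree u = M"
    using M degree_add_eq_left[of "- 1" "monom (1::int) M"] by (simp add: u_def degree_monom_eq)
  have lead_u: "coeff u M = 1" using M by (simp add: u_def)
  have "u \<noteq> 0" using deg_u M by auto
  \<comment> \<open>Since \<open>u\<close> is monic, this pseudo-division introduces no
    multiplier.\<close>
  obtain q0 r where "pseudo_divmod p u = (q0, r)" by fastforce
  from pseudo_divmod[OF \<open>u \<noteq> 0\<close> this] have r: "p = u * q0 + r" "r = 0 \<or> degree r < M"
    unfolding deg_u lead_u by auto
  have "f \<noteq> 0" using f by (simp add: min_int_poly_of_def)
  obtain q1 g0 where "pseudo_divmod r f = (q1, g0)" by fastforce
  note g0 = pseudo_divmod[OF \<open>f \<noteq> 0\<close> this]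
  \<comment> \<open>The exponent of the leading coefficient in the pseudo-division of
    \<open>r\<close> by \<open>f\<close>. It varies with the degree of \<open>r\<close>; the factor
    in \<open>g\<close> below pads it to the fixed exponent \<open>M\<close>.\<close>
  define e where "e = Suc (degree r) - degree f"
  have "e \<le> M" using r M by (auto simp: e_def)
  define g where "g = Polynomial.smult (lead_coeff f ^ (M - e)) g0"
  show ?thesis
  proof
    show "g = 0 \<or> degree g < degree f" using g0 by (auto simp: g_def)
    fix t assume t: "int_eval f t = 0"
    have "int_eval u t = 0"
      using conjugate_root_of_unity[OF f M(1) t] by (simp add: u_def hom_distribs poly_monom)
    then have p: "int_eval p t = int_eval r t" unfolding r(1) by (simp add: hom_distribs)
    have "of_int (lead_coeff f ^ e) * int_eval r t
        = int_eval (Polynomial.smult (lead_coeff f ^ e) r) t" by (simp add: hom_distribs)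
    also have "\<dots> = int_eval g0 t" unfolding e_def g0(1) using t by (simp add: hom_distribs)
    finally have "int_eval g t = of_int (lead_coeff f ^ (M - e) * lead_coeff f ^ e) * int_eval r t"
      by (simp add: g_def hom_distribs mult.assoc)
    then show "int_eval g t = of_int (lead_coeff f ^ M) * int_eval p t"
      using \<open>e \<le> M\<close> by (simp add: p flip: power_add)
  qed
qed

text \<open>The polynomials \<open>p\<close> have unbounded degree, but each can be replaced by a
  reduced \<open>g\<close> whose values at the conjugates are those of \<open>p\<close> times a
  fixed constant. Only finitely many such \<open>g\<close> satisfy the scaled bound.\<close>

lemma finite_cyclotomic_integers_bounded_at_conjugates:
  assumes f: "min_int_poly_of z f" and M: "z ^ M = 1" "M > 0"
  shows "finite {int_eval p z | p. \<forall>t. int_eval f t = 0 \<longrightarrow> cmod (int_eval p t) \<le> B}"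
proof -
  define S where "S = {t. int_eval f t = 0}"
  have S: "finite S" "card S = degree f" unfolding S_def using card_conjugates[OF f M] by auto
  have "z \<in> S" using f by (simp add: S_def min_int_poly_of_def)
  \<comment> \<open>Positivity is what puts the case \<open>g = 0\<close> below the degree
    bound.\<close>
  then have "degree f > 0" using S by (metis card_gt_0_iff empty_iff)
  define c where "c = (of_int (lead_coeff f ^ M) :: complex)"
  have "c \<noteq> 0" using f by (simp add: c_def min_int_poly_of_def)
  show ?thesis
  proof (rule finite_subset)
    show "{int_eval p z | p. \<forall>t. int_eval f t = 0 \<longrightarrow> cmod (int_eval p t) \<le> B}
      \<subseteq> (\<lambda>g. int_eval g z / c) `
        {g. degree g < card S \<and> (\<forall>t\<in>S. cmod (int_eval g t) \<le> cmod c * B)}"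
    proof safe
      fix p assume p: "\<forall>t. int_eval f t = 0 \<longrightarrow> cmod (int_eval p t) \<le> B"
      obtain g where g: "g = 0 \<or> degree g < degree f"
        "\<And>t. int_eval f t = 0 \<Longrightarrow> int_eval g t = c * int_eval p t"
        using conjugate_values_reduced[OF f M] unfolding c_def by blast
      have "int_eval p z = int_eval g z / c" using g(2) \<open>z \<in> S\<close> \<open>c \<noteq> 0\<close> by (simp add: S_def)
      moreover have "degree g < card S" using g(1) S \<open>degree f > 0\<close> by auto
      moreover have "\<forall>t\<in>S. cmod (int_eval g t) \<le> cmod c * B"
        using p g(2) by (auto simp: S_def norm_mult mult_left_mono)
      ultimately show "int_eval p z \<in> (\<lambda>g. int_eval g z / c) `
        {g. degree g < card S \<and> (\<forall>t\<in>S. cmod (int_eval g t) \<le> cmod c * B)}" by blast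
    qed
  qed (intro finite_imageI finite_int_polys_bounded_at_conjugates S)
qed

subsection \<open>Finiteness over the cyclotomic integers\<close>

context comm_ring_hom
begin

text \<open>Row values of words are polynomial in the entries of \<open>A\<close>, so they commute
  with ring homomorphisms. The cases in use are evaluation at \<open>z\<close>, evaluation at a
  conjugate, and the embedding of the reals into the complex numbers.\<close>

lemma hom_gram_row: "hom (gram_row A I x i) = gram_row (\<lambda>i j. hom (A i j)) I (\<lambda>j. hom (x j)) i"
  by (simp add: gram_row_def hom_distribs)

lemma hom_reflect:
  "(\<lambda>j. hom (reflect A I i x j)) = reflect (\<lambda>i j. hom (A i j)) I i (\<lambda>j. hom (x j))"
  by (auto simp: reflect_def hom_distribs hom_gram_row)

lemma hom_reflects:
  "(\<lambda>j. hom (reflects A I is x j)) = reflects (\<lambda>i j. hom (A i j)) I is (\<lambda>j. hom (x j))"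
  by (induction "is") (simp_all add: hom_reflect)

lemma hom_funpow_reflects:
  "(\<lambda>j. hom ((reflects A I is ^^ n) x j))
    = (reflects (\<lambda>i j. hom (A i j)) I is ^^ n) (\<lambda>j. hom (x j))"
  by (induction n) (simp_all add: hom_reflects)

lemma hom_basis_fun: "(\<lambda>i. hom (basis_fun j i)) = basis_fun j"
  by (auto simp: basis_fun_def)

lemma hom_row_of_reflects_basis:
  "hom (gram_row A I (reflects A I is (basis_fun j)) k)
    = gram_row (\<lambda>i j. hom (A i j)) I (reflects (\<lambda>i j. hom (A i j)) I is (basis_fun j)) k"
  by (simp add: hom_gram_row hom_reflects hom_basis_fun)

lemma hom_row_of_power_diff:
  "hom (gram_row A I (\<lambda>i. (reflects A I is ^^ n) (basis_fun j) i - basis_fun j i) k)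
    = gram_row (\<lambda>i j. hom (A i j)) I
        (\<lambda>i. (reflects (\<lambda>i j. hom (A i j)) I is ^^ n) (basis_fun j) i - basis_fun j i) k"
  by (simp add: hom_gram_row hom_distribs hom_basis_fun fun_cong[OF hom_basis_fun] fun_cong[OF hom_funpow_reflects])

end

lemma comm_ring_hom_int_eval: "comm_ring_hom (\<lambda>p. int_eval p z)"
  by unfold_locales (simp_all add: hom_distribs)

lemma basis_fun_expansion:
  fixes x :: "'i \<Rightarrow> 'a::comm_ring_1"
  assumes "finite K" "\<And>i. i \<notin> K \<Longrightarrow> x i = 0"
  shows "x = (\<lambda>i. \<Sum>j\<in>K. x j * basis_fun j i)"
proof
  fix i
  have "(\<Sum>j\<in>K. x j * basis_fun j i) = (\<Sum>j\<in>K. if i = j then x j else 0)"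
    by (intro sum.cong) (auto simp: basis_fun_def)
  then show "x i = (\<Sum>j\<in>K. x j * basis_fun j i)" using assms by simp
qed

lemma gram_row_sum: "gram_row A I (\<lambda>i. \<Sum>j\<in>K. x j i) k = (\<Sum>j\<in>K. gram_row A I (x j) k)"
  by (induction K rule: infinite_finite_induct) (simp_all add: gram_row_zero gram_row_add)

text \<open>Only basis vectors give relations between integer polynomials, so torsion is transferred
  to conjugates for these; linearity then extends it to all real coefficient vectors supported on
  \<open>K\<close>.\<close>

lemma row_of_power_diff_eq_0:
  assumes "finite K"
    and basis: "\<And>j. j \<in> K \<Longrightarrow>
      gram_row A I (\<lambda>i. (reflects A I is ^^ N) (basis_fun j) i - basis_fun j i) k = 0"
    and supp: "\<And>i. i \<notin> K \<Longrightarrow> x i = 0"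
  shows "gram_row A I (\<lambda>i. (reflects A I is ^^ N) x i - x i) k = 0"
proof -
  note x = basis_fun_expansion[OF \<open>finite K\<close> supp]
  have "(\<lambda>i. (reflects A I is ^^ N) x i - x i)
      = (\<lambda>i. \<Sum>j\<in>K. x j * ((reflects A I is ^^ N) (basis_fun j) i - basis_fun j i))"
    by (subst (1 2) x)
      (simp_all add: funpow_reflects_sum funpow_reflects_scale right_diff_distrib sum_subtractf)
  then show ?thesis by (simp add: gram_row_sum gram_row_scale basis)
qed

text \<open>Writing the entries as \<open>z ^ m + z ^ (M - m)\<close> avoids negative exponents, so
  that they are values of integer polynomials at \<open>z\<close>. At each conjugate the matrix is
  real and positive semidefinite, which bounds all row values there by 2.\<close>

lemma finite_rows_of_reflects:
  fixes a :: "'i \<Rightarrow> 'i \<Rightarrow> complex"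
  assumes I: "finite I" and sym: "\<And>i j. a i j = a j i" and diag: "\<And>i. a i i = 2"
    and M: "z ^ M = 1" "M > 0"
    and cyclotomic: "\<And>i j. \<exists>m\<le>M. a i j = z ^ m + z ^ (M - m)"
    and torsion: "\<And>K. K \<subseteq> I \<Longrightarrow> \<exists>is N. distinct is \<and> set is = K \<and> N > 0 \<and> (\<forall>j\<in>K. \<forall>k\<in>K.
      gram_row a I (\<lambda>i. (reflects a I is ^^ N) (basis_fun j) i - basis_fun j i) k = 0)"
  shows "finite {gram_row a I (reflects a I is (basis_fun j)) k | is j k.
    set is \<subseteq> I \<and> j \<in> I \<and> k \<in> I}"
proof -
  obtain m where m: "\<And>i j. m i j \<le> M" "\<And>i j. a i j = z ^ m i j + z ^ (M - m i j)"
    using cyclotomic by metis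
  define q where "q i j = (monom 1 (m i j) + monom 1 (M - m i j) :: int poly)" for i j
  have q_eval: "int_eval (q i j) t = t ^ m i j + t ^ (M - m i j)" for i j t
    by (simp add: q_def hom_distribs poly_monom)
  then have q_z: "(\<lambda>i j. int_eval (q i j) z) = a" by (simp add: m(2) fun_eq_iff)
  have "monom 1 M - 1 \<noteq> (0 :: int poly)"
  proof
    assume "monom 1 M - 1 = (0 :: int poly)"
    then have "coeff (monom 1 M - 1 :: int poly) M = 0" by simp
    then show False using M by simp
  qed
  moreover have "int_eval (monom 1 M - 1) z = 0" using M by (simp add: hom_distribs poly_monom)
  ultimately obtain f where f: "min_int_poly_of z f" using min_int_poly_of_exists by blast
  interpret z: comm_ring_hom "\<lambda>p. int_eval p z" by (rule comm_ring_hom_int_eval)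
  have bound: "cmod (int_eval (gram_row q I (reflects q I is (basis_fun j)) k) t) \<le> 2"
    if t: "int_eval f t = 0" and w: "set is \<subseteq> I" "j \<in> I" "k \<in> I" for t "is" j k
  proof -
    interpret t: comm_ring_hom "\<lambda>p. int_eval p t" by (rule comm_ring_hom_int_eval)
    have "t ^ M = 1" using conjugate_root_of_unity[OF f M(1) t] .
    then have "norm t = 1" using M(2) by (metis norm_one norm_power power_eq_1_iff norm_ge_zero less_irrefl)
    \<comment> \<open>On the unit circle the inverse of \<open>t ^ m\<close> is its complex
      conjugate, so the entries at \<open>t\<close> are real and equal to \<open>b\<close>.\<close>
    define b where "b i j = Re (int_eval (q i j) t)" for i j
    have b: "int_eval (q i j) t = of_real (b i j)" for i j
    proof -
      have "t ^ m i j * t ^ (M - m i j) = 1"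
        using m(1) \<open>t ^ M = 1\<close> by (simp flip: power_add)
      moreover have "t ^ m i j * cnj (t ^ m i j) = 1"
        using \<open>norm t = 1\<close> by (simp add: flip: power_mult_distrib complex_norm_square)
      ultimately have inv: "t ^ (M - m i j) = cnj (t ^ m i j)"
        by (metis mult_cancel_left mult_zero_left zero_neq_one)
      have "w + cnj w = of_real (Re (w + cnj w))" for w by (simp add: complex_eq_iff)
      then show ?thesis unfolding b_def q_eval inv .
    qed
    then have q_t: "(\<lambda>i j. int_eval (q i j) t) = (\<lambda>i j. of_real (b i j))" by simp
    \<comment> \<open>Symmetry and the diagonal value 2 are integer polynomial identities at
      \<open>z\<close>, hence persist at \<open>t\<close>.\<close>
    have eq_conj: "int_eval p t = int_eval p' t" if "int_eval p z = int_eval p' z" for p p'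
      using conjugate_root[OF f _ t, of "p - p'"] that by (simp add: hom_distribs)
    have "symmetric_gram b I"
    proof
      show "finite I" by fact
      show "b i j = b j i" for i j
        using eq_conj[of "q i j" "q j i"] sym fun_cong[OF fun_cong[OF q_z]] by (simp add: b_def)
      show "b i i = 2" for i
        using eq_conj[of "q i i" "[:2:]"] diag fun_cong[OF fun_cong[OF q_z]] by (simp add: b_def)
    qed
    have "psd_on b I I"
    proof (rule psd_if_ordered_products_torsion[OF \<open>symmetric_gram b I\<close> _ order_refl])
      fix K assume K: "K \<subseteq> I"
      obtain js N where js: "distinct js" "set js = K" "N > 0"
        and tor: "\<And>j k. j \<in> K \<Longrightarrow> k \<in> K \<Longrightarrow>
          gram_row a I (\<lambda>i. (reflects a I js ^^ N) (basis_fun j) i - basis_fun j i) k = 0"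
        using torsion[OF K] by blast
      have "gram_row b I (\<lambda>i. (reflects b I js ^^ N) (basis_fun j) i - basis_fun j i) k = 0"
        if "j \<in> K" "k \<in> K" for j k
      proof -
        \<comment> \<open>One integer polynomial whose vanishing at \<open>z\<close> is the torsion
          relation for \<open>j\<close> and \<open>k\<close>; it then vanishes at \<open>t\<close>
          as well.\<close>
        define D where "D = gram_row q I (\<lambda>i. (reflects q I js ^^ N) (basis_fun j) i - basis_fun j i) k"
        have "int_eval D z = 0" unfolding D_def z.hom_row_of_power_diff q_z using tor that by simp
        then have "int_eval D t = 0" using conjugate_root[OF f _ t] by blast
        then have "complex_of_real
            (gram_row b I (\<lambda>i. (reflects b I js ^^ N) (basis_fun j) i - basis_fun j i) k) = 0"
          unfolding D_def t.hom_row_of_power_diff q_t of_real_hom.hom_row_of_power_diff .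
        then show ?thesis by simp
      qed
      then have "gram_row b I (\<lambda>j. (reflects b I js ^^ N) x j - x j) k = 0"
        if "\<forall>i. i \<notin> K \<longrightarrow> x i = 0" "k \<in> K" for x k
        using row_of_power_diff_eq_0[of K b I N js k x] finite_subset[OF K I] that by simp
      then show "\<exists>is N. distinct is \<and> set is = K \<and> N > 0 \<and> (\<forall>x. (\<forall>i. i \<notin> K \<longrightarrow> x i = 0) \<longrightarrow>
          (\<forall>k\<in>K. gram_row b I (\<lambda>j. (reflects b I is ^^ N) x j - x j) k = 0))"
        using js by (intro exI[of _ js] exI[of _ N]) simp
    qed
    from psd_row_bound[OF \<open>symmetric_gram b I\<close> this w]
    have "cmod (complex_of_real (gram_row b I (reflects b I is (basis_fun j)) k)) \<le> 2" by simp
    then show ?thesis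
      unfolding t.hom_row_of_reflects_basis q_t of_real_hom.hom_row_of_reflects_basis .
  qed
  have "gram_row a I (reflects a I is (basis_fun j)) k
      = int_eval (gram_row q I (reflects q I is (basis_fun j)) k) z" for "is" j k
    unfolding z.hom_row_of_reflects_basis q_z ..
  then have "{gram_row a I (reflects a I is (basis_fun j)) k | is j k. set is \<subseteq> I \<and> j \<in> I \<and> k \<in> I}
      \<subseteq> {int_eval p z | p. \<forall>t. int_eval f t = 0 \<longrightarrow> cmod (int_eval p t) \<le> 2}"
    using bound by (intro subsetI, unfold mem_Collect_eq) metis
  then show ?thesis
    using finite_cyclotomic_integers_bounded_at_conjugates[OF f M] finite_subset by blast
qed

subsection \<open>Complex reflections and their Gram matrix\<close>

definition refl_vec :: "complex vec \<Rightarrow> complex vec \<Rightarrow> complex vec" where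
  "refl_vec w v = v - (2 * (v \<bullet> w)) \<cdot>\<^sub>v w"

lemma refl_vec_carrier [simp]:
  "w \<in> carrier_vec n \<Longrightarrow> v \<in> carrier_vec n \<Longrightarrow> refl_vec w v \<in> carrier_vec n"
  by (simp add: refl_vec_def)

lemma refl_vec_scalar_prod:
  assumes "v \<in> carrier_vec n" "w \<in> carrier_vec n" "x \<in> carrier_vec n"
  shows "refl_vec w v \<bullet> x = v \<bullet> refl_vec w x"
  using assms
  by (simp add: refl_vec_def minus_scalar_prod_distrib[of _ n] scalar_prod_minus_distrib[of _ n]
      comm_scalar_prod[of x n w])

lemma refl_vec_involution:
  assumes "v \<in> carrier_vec n" "w \<in> carrier_vec n" "w \<bullet> w = 1"
  shows "refl_vec w (refl_vec w v) = v"
  using assms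
  by (intro eq_vecI)
    (simp_all add: refl_vec_def minus_scalar_prod_distrib[of _ n] algebra_simps)

lemma refl_vec_fixed:
  assumes "w \<in> carrier_vec n" "v \<in> carrier_vec n" "v \<bullet> w = 0"
  shows "refl_vec w v = v"
  using assms by (intro eq_vecI) (simp_all add: refl_vec_def)

lemma refl_vec_add:
  assumes "w \<in> carrier_vec n" "v \<in> carrier_vec n" "v' \<in> carrier_vec n"
  shows "refl_vec w (v + v') = refl_vec w v + refl_vec w v'"
  using assms
  by (intro eq_vecI) (simp_all add: refl_vec_def add_scalar_prod_distrib[of _ n] algebra_simps)

lemma refl_vec_smult:
  assumes "w \<in> carrier_vec n" "v \<in> carrier_vec n"
  shows "refl_vec w (c \<cdot>\<^sub>v v) = c \<cdot>\<^sub>v refl_vec w v"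
  using assms by (intro eq_vecI) (simp_all add: refl_vec_def algebra_simps)

locale reflection_tuple =
  fixes n :: nat and I :: "nat set" and u :: "nat \<Rightarrow> complex vec"
  assumes finite_I: "finite I"
    and u_carrier [simp]: "i \<in> I \<Longrightarrow> u i \<in> carrier_vec n"
    and u_unit: "i \<in> I \<Longrightarrow> u i \<bullet> u i = 1"
begin

abbreviation word :: "nat list \<Rightarrow> complex vec \<Rightarrow> complex vec" where
  "word is \<equiv> foldr (\<lambda>i. refl_vec (u i)) is"

lemma word_carrier [simp]: "set is \<subseteq> I \<Longrightarrow> v \<in> carrier_vec n \<Longrightarrow> word is v \<in> carrier_vec n"
  by (induction "is") auto

text \<open>Each reflection is self-adjoint for the bilinear form, so taking the adjoint of a word
  reverses it.\<close>

lemma word_scalar_prod: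
  assumes "set is \<subseteq> I" "v \<in> carrier_vec n" "x \<in> carrier_vec n"
  shows "word is v \<bullet> x = v \<bullet> word (rev is) x"
  using assms by (induction "is" arbitrary: x) (auto simp: refl_vec_scalar_prod[of _ n])

lemma word_fixed:
  assumes "set is \<subseteq> I" "v \<in> carrier_vec n" "\<And>i. i \<in> I \<Longrightarrow> v \<bullet> u i = 0"
  shows "word is v = v"
  using assms(1) by (induction "is") (auto simp: refl_vec_fixed[of _ n] assms)

text \<open>The value 2 outside \<open>I\<close> makes the cyclotomic form of the entries hold for all indices.\<close>

definition gram :: "nat \<Rightarrow> nat \<Rightarrow> complex" where
  "gram i j = (if i \<in> I \<and> j \<in> I then 2 * (u i \<bullet> u j) else 2)"

definition comb :: "(nat \<Rightarrow> complex) \<Rightarrow> complex vec" where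
  "comb x = vec n (\<lambda>k. \<Sum>i\<in>I. x i * u i $ k)"

lemma comb_carrier [simp]: "comb x \<in> carrier_vec n"
  by (simp add: comb_def)

lemma comb_add: "comb (\<lambda>i. x i + y i) = comb x + comb y"
  by (intro eq_vecI) (simp_all add: comb_def algebra_simps sum.distrib)

lemma comb_diff: "comb (\<lambda>i. x i - y i) = comb x - comb y"
  by (intro eq_vecI) (simp_all add: comb_def algebra_simps sum_subtractf)

lemma comb_basis: "i \<in> I \<Longrightarrow> comb (basis_fun i) = u i"
proof (intro eq_vecI)
  assume i: "i \<in> I"
  then have [simp]: "dim_vec (u i) = n" using u_carrier carrier_vecD by blast
  then show "dim_vec (comb (basis_fun i)) = dim_vec (u i)" by (simp add: comb_def)
  fix k assume "k < dim_vec (u i)"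
  have "(\<Sum>j\<in>I. basis_fun i j * u j $ k) = (\<Sum>j\<in>I. if j = i then u j $ k else 0)"
    by (intro sum.cong) (auto simp: basis_fun_def)
  then show "comb (basis_fun i) $ k = u i $ k"
    using i finite_I \<open>k < dim_vec (u i)\<close> by (simp add: comb_def)
qed

lemma comb_scalar_prod:
  assumes "w \<in> carrier_vec n"
  shows "comb x \<bullet> w = (\<Sum>i\<in>I. x i * (u i \<bullet> w))"
proof -
  have "comb x \<bullet> w = (\<Sum>k<n. \<Sum>i\<in>I. x i * (u i $ k * w $ k))"
    using assms by (simp add: scalar_prod_def comb_def sum_distrib_right mult.assoc atLeast0LessThan)
  also have "\<dots> = (\<Sum>i\<in>I. \<Sum>k<n. x i * (u i $ k * w $ k))" by (rule sum.swap)
  also have "\<dots> = (\<Sum>i\<in>I. x i * (u i \<bullet> w))"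
    using assms by (simp add: scalar_prod_def sum_distrib_left atLeast0LessThan)
  finally show ?thesis .
qed

lemma gram_row_eq_scalar_prod:
  assumes "i \<in> I"
  shows "gram_row gram I x i = 2 * (comb x \<bullet> u i)"
  using assms
  by (simp add: gram_row_def gram_def comb_scalar_prod sum_distrib_left comm_scalar_prod[of "u i" n] algebra_simps
      cong: sum.cong)

text \<open>\<open>comb\<close> intertwines the two kinds of reflection even when the
  \<open>u i\<close> are linearly dependent, because the row of \<open>x\<close> at \<open>i\<close>
  depends only on \<open>comb x\<close>.\<close>

lemma comb_reflect:
  assumes "i \<in> I"
  shows "comb (reflect gram I i x) = refl_vec (u i) (comb x)"
proof -
  define c where "c = gram_row gram I x i"
  have "reflect gram I i x = (\<lambda>j. x j - c * basis_fun i j)"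
    by (auto simp: reflect_def basis_fun_def c_def)
  moreover have "comb (\<lambda>j. c * basis_fun i j) = c \<cdot>\<^sub>v comb (basis_fun i)"
    by (intro eq_vecI) (simp_all add: comb_def sum_distrib_left mult.assoc)
  ultimately show ?thesis
    using assms by (simp add: comb_diff comb_basis refl_vec_def c_def gram_row_eq_scalar_prod)
qed

lemma comb_reflects:
  assumes "set is \<subseteq> I"
  shows "comb (reflects gram I is x) = word is (comb x)"
  using assms by (induction "is") (auto simp: comb_reflect)

lemma comb_funpow_reflects:
  assumes "set is \<subseteq> I"
  shows "comb ((reflects gram I is ^^ N) x) = (word is ^^ N) (comb x)"
  using assms by (induction N) (auto simp: comb_reflects)

text \<open>Each reflection moves a vector by a multiple of some \<open>u i\<close>. This reduces
  the comparison of two words to vectors in the span, where the form can be used.\<close>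

lemma word_displacement:
  assumes "set is \<subseteq> I" "v \<in> carrier_vec n"
  shows "\<exists>x. word is v = v + comb x"
  using assms(1)
proof (induction "is")
  case Nil
  have "comb (\<lambda>_. 0) = 0\<^sub>v n" by (intro eq_vecI) (simp_all add: comb_def)
  then have "word [] v = v + comb (\<lambda>_. 0)" using assms by simp
  then show ?case by blast
next
  case (Cons i "is")
  then obtain x where x: "word is v = v + comb x" by auto
  have i: "i \<in> I" using Cons by auto
  have "word (i # is) v = refl_vec (u i) v + comb (reflect gram I i x)"
    using i assms by (simp add: x refl_vec_add[of _ n] comb_reflect)
  also have "refl_vec (u i) v = v + comb (\<lambda>j. - (2 * (v \<bullet> u i)) * basis_fun i j)"
  proof -
    have "comb (\<lambda>j. - (2 * (v \<bullet> u i)) * basis_fun i j) = - (2 * (v \<bullet> u i)) \<cdot>\<^sub>v comb (basis_fun i)"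
      by (intro eq_vecI) (simp_all add: comb_def sum_distrib_left mult.assoc)
    then show ?thesis using i assms(2) by (intro eq_vecI) (simp_all add: refl_vec_def comb_basis)
  qed
  finally have "word (i # is) v
      = v + comb (\<lambda>j. - (2 * (v \<bullet> u i)) * basis_fun i j + reflect gram I i x j)"
    unfolding comb_add using assms(2) by (simp only: assoc_add_vec[of v n] comb_carrier)
  then show ?case by blast
qed

end

section \<open>Torsion of two-letter products and the entries of the Gram matrix\<close>

lemma reflective_eigenvector:
  assumes w: "w \<in> carrier_vec n" "w' \<in> carrier_vec n" "w \<bullet> w = 1" "w' \<bullet> w' = 1"
    and \<mu>: "\<mu> ^ 2 + 1 = \<mu> * (2 * (w \<bullet> w'))"
  defines "v \<equiv> w' - \<mu> \<cdot>\<^sub>v w"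
  shows "refl_vec w (refl_vec w' v) = \<mu>\<^sup>2 \<cdot>\<^sub>v v"
proof -
  define a where "a = 2 * (w \<bullet> w')"
  have comm: "w' \<bullet> w = w \<bullet> w'" using w comm_scalar_prod by blast
  have \<mu>2: "\<mu>\<^sup>2 = \<mu> * a - 1" using \<mu> by (simp add: a_def algebra_simps)
  have sv: "2 * (v \<bullet> w') = 2 - \<mu> * a"
    using w by (simp add: v_def a_def minus_scalar_prod_distrib[of _ n])
  then have 1: "refl_vec w' v = \<mu>\<^sup>2 \<cdot>\<^sub>v w' - \<mu> \<cdot>\<^sub>v w"
    unfolding refl_vec_def sv using w
    by (intro eq_vecI) (simp_all add: v_def \<mu>2 algebra_simps)
  have 2: "2 * ((\<mu>\<^sup>2 \<cdot>\<^sub>v w' - \<mu> \<cdot>\<^sub>v w) \<bullet> w) = \<mu>\<^sup>2 * a - 2 * \<mu>"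
    using w by (simp add: a_def minus_scalar_prod_distrib[of _ n] comm algebra_simps)
  have 3: "\<mu>\<^sup>2 * a = \<mu> ^ 3 + \<mu>"
  proof -
    have "\<mu>\<^sup>2 * a = \<mu> * (\<mu> * a)" by (simp add: power2_eq_square)
    also have "\<mu> * a = \<mu>\<^sup>2 + 1" using \<mu> by (simp add: a_def)
    finally show ?thesis by (simp add: power2_eq_square power3_eq_cube algebra_simps)
  qed
  show ?thesis
    unfolding 1 unfolding refl_vec_def 2 3 using w
    by (intro eq_vecI) (simp_all add: v_def power2_eq_square power3_eq_cube algebra_simps)
qed

text \<open>The product of the two reflections multiplies \<open>w' - \<mu> w\<close> by
  \<open>\<mu>\<close> squared, which accounts for the exponent \<open>2 * N\<close>.\<close>

lemma root_of_unity_if_product_torsion: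
  assumes w: "w \<in> carrier_vec n" "w' \<in> carrier_vec n" "w \<bullet> w = 1" "w' \<bullet> w' = 1"
    and tor: "\<And>v. v \<in> carrier_vec n \<Longrightarrow> ((\<lambda>v. refl_vec w (refl_vec w' v)) ^^ N) v = v"
    and \<mu>: "\<mu> ^ 2 + 1 = \<mu> * (2 * (w \<bullet> w'))"
  shows "\<mu> ^ (2 * N) = 1"
proof -
  define v where "v = w' - \<mu> \<cdot>\<^sub>v w"
  have v: "v \<in> carrier_vec n" using w by (simp add: v_def)
  let ?T = "\<lambda>v. refl_vec w (refl_vec w' v)"
  have "(?T ^^ k) v = (\<mu>\<^sup>2) ^ k \<cdot>\<^sub>v v" for k
  proof (induction k)
    case (Suc k)
    have "?T ((\<mu>\<^sup>2) ^ k \<cdot>\<^sub>v v) = (\<mu>\<^sup>2) ^ k \<cdot>\<^sub>v ?T v"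
      using w v by (simp add: refl_vec_smult[of _ n])
    also have "?T v = \<mu>\<^sup>2 \<cdot>\<^sub>v v"
      unfolding v_def by (rule reflective_eigenvector[OF w \<mu>])
    finally show ?case using Suc by (simp add: smult_smult_assoc mult.commute)
  qed (use v in simp)
  from this[of N] tor[OF v] have eq: "v = \<mu> ^ (2 * N) \<cdot>\<^sub>v v" by (simp add: power_mult)
  show ?thesis
  proof (cases "v = 0\<^sub>v n")
    case True
    \<comment> \<open>The degenerate case: \<open>w'\<close> is \<open>\<mu>\<close> times
      \<open>w\<close>, and comparing the two unit vectors shows that the square of
      \<open>\<mu>\<close> is 1.\<close>
    have "w' = v + \<mu> \<cdot>\<^sub>v w" using w by (intro eq_vecI) (auto simp: v_def)
    then have "w' = \<mu> \<cdot>\<^sub>v w" using True w by simp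
    then have "\<mu>\<^sup>2 = 1" using w by (simp add: power2_eq_square)
    then show ?thesis by (simp add: power_mult)
  next
    case False
    then obtain k where k: "k < n" "v $ k \<noteq> 0" using v by (metis eq_vecI carrier_vecD index_zero_vec)
    from arg_cong[OF eq, of "\<lambda>x. x $ k"] k v show ?thesis by simp
  qed
qed

lemma exists_reciprocal_root: "\<exists>\<mu>::complex. \<mu>\<^sup>2 + 1 = \<mu> * a"
proof
  define s where "s = csqrt (a\<^sup>2 - 4)"
  have "s\<^sup>2 = a\<^sup>2 - 4" by (simp add: s_def)
  moreover have "((a + s) / 2)\<^sup>2 + 1 - ((a + s) / 2) * a = (s\<^sup>2 - (a\<^sup>2 - 4)) / 4"
    by (simp add: power2_eq_square field_simps)
  ultimately show "((a + s) / 2)\<^sup>2 + 1 = ((a + s) / 2) * a" by simp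
qed

context reflection_tuple
begin

lemma gram_cyclotomic:
  assumes "N > 0"
    and tor: "\<And>i j v. i \<in> I \<Longrightarrow> j \<in> I \<Longrightarrow> i < j \<Longrightarrow> v \<in> carrier_vec n \<Longrightarrow> (word [i, j] ^^ N) v = v"
  defines "M \<equiv> 2 * N"
  defines "z \<equiv> cis (2 * pi / real M)"
  shows "\<exists>m\<le>M. gram i j = z ^ m + z ^ (M - m)"
proof -
  have "M > 0" using assms by simp
  have zpow: "z ^ m = cis (2 * pi * real m / real M)" for m
    by (simp add: z_def DeMoivre mult.commute)
  have zM: "z ^ M = 1" using \<open>M > 0\<close> by (simp add: zpow)
  \<comment> \<open>The choice \<open>m = 0\<close> gives \<open>1 + z ^ M\<close>, which is
    2.\<close>
  have diag: ?thesis if "gram i j = 2"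
    using that by (intro exI[of _ 0]) (simp add: zM)
  \<comment> \<open>Two-letter words are known to be torsion only for \<open>i < j\<close>; the
    other order follows from the symmetry of the Gram matrix.\<close>
  have less: "\<exists>m\<le>M. gram i j = z ^ m + z ^ (M - m)" if ij: "i \<in> I" "j \<in> I" "i < j" for i j
  proof -
    obtain \<mu> where \<mu>: "\<mu>\<^sup>2 + 1 = \<mu> * (2 * (u i \<bullet> u j))" using exists_reciprocal_root by blast
    have "(\<lambda>v. refl_vec (u i) (refl_vec (u j) v)) = word [i, j]" by (simp add: fun_eq_iff)
    then have "\<mu> ^ M = 1"
      unfolding M_def
      using root_of_unity_if_product_torsion[of "u i" n "u j" N \<mu>] ij tor u_unit \<mu> by simp
    then obtain m where m: "m < M" "\<mu> = z ^ m"
      using bij_betw_roots_unity[OF \<open>M > 0\<close>] unfolding bij_betw_def zpow by blast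
    have "\<mu> * z ^ (M - m) = 1" using m zM by (simp flip: power_add)
    moreover have "\<mu> * (2 * (u i \<bullet> u j) - \<mu>) = 1" using \<mu> by (simp add: algebra_simps power2_eq_square)
    moreover have "\<mu> \<noteq> 0" using \<mu> by auto
    ultimately have "2 * (u i \<bullet> u j) - \<mu> = z ^ (M - m)" by (metis mult_cancel_left)
    then have "gram i j = z ^ m + z ^ (M - m)" using ij m by (simp add: gram_def algebra_simps)
    then show ?thesis using m by (meson less_imp_le)
  qed
  have sym: "gram i j = gram j i"
    using comm_scalar_prod[of "u i" n "u j"] by (simp add: gram_def)
  show ?thesis
  proof (cases "i \<in> I \<and> j \<in> I \<and> i \<noteq> j")
    case True
    then show ?thesis using less[of i j] less[of j i] sym by (cases i j rule: linorder_cases) auto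
  next
    case False
    then show ?thesis by (intro diag) (auto simp: gram_def u_unit)
  qed
qed

text \<open>The increasing enumeration of a subset \<open>K\<close> is the ordering whose product is
  torsion, so increasing words suffice for the hypothesis about all subsets.\<close>

lemma finite_gram_rows:
  assumes "N > 0"
    and tor: "\<And>is v. is \<noteq> [] \<Longrightarrow> sorted_wrt (<) is \<Longrightarrow> set is \<subseteq> I \<Longrightarrow> v \<in> carrier_vec n \<Longrightarrow>
      (word is ^^ N) v = v"
  shows "finite {gram_row gram I (reflects gram I is (basis_fun j)) k | is j k.
    set is \<subseteq> I \<and> j \<in> I \<and> k \<in> I}"
proof (rule finite_rows_of_reflects[OF finite_I])
  show "gram i j = gram j i" for i j
    using comm_scalar_prod[of "u i" n "u j"] by (simp add: gram_def)
  show "gram i i = 2" for i by (simp add: gram_def u_unit)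
  show "cis (2 * pi / real (2 * N)) ^ (2 * N) = 1" using assms(1) by (simp add: DeMoivre)
  show "2 * N > 0" using assms(1) by simp
  show "\<exists>m\<le>2 * N. gram i j = cis (2 * pi / real (2 * N)) ^ m + cis (2 * pi / real (2 * N)) ^ (2 * N - m)"
    for i j
    by (rule gram_cyclotomic[OF assms(1)]) (rule tor, auto)
  fix K assume K: "K \<subseteq> I"
  have finK: "finite K" using K finite_I finite_subset by blast
  define ks where "ks = sorted_list_of_set K"
  have ks: "sorted_wrt (<) ks" "set ks = K" "distinct ks"
    using finK by (auto simp: ks_def strict_sorted_list_of_set)
  have "gram_row gram I (\<lambda>i. (reflects gram I ks ^^ N) (basis_fun j) i - basis_fun j i) k = 0"
    if jk: "j \<in> K" "k \<in> K" for j k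
  proof -
    \<comment> \<open>An empty \<open>K\<close> contains no \<open>j\<close>, so the empty word
      never arises here.\<close>
    have "ks \<noteq> []" using jk ks by auto
    have "comb ((reflects gram I ks ^^ N) (basis_fun j)) = comb (basis_fun j)"
      using comb_funpow_reflects[of ks N] tor[OF \<open>ks \<noteq> []\<close> ks(1)] ks K by simp
    moreover have "k \<in> I" using jk K by auto
    ultimately show ?thesis by (simp add: gram_row_diff gram_row_eq_scalar_prod)
  qed
  then show "\<exists>is N. distinct is \<and> set is = K \<and> N > 0 \<and> (\<forall>j\<in>K. \<forall>k\<in>K.
      gram_row gram I (\<lambda>i. (reflects gram I is ^^ N) (basis_fun j) i - basis_fun j i) k = 0)"
    using ks assms(1) by (intro exI[of _ ks] exI[of _ N]) simp
qed

text \<open>A matrix acting as a word is determined by how the inverse word acts on the vectors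
  \<open>u k\<close>, since its displacements lie in their span, on which the form is nondegenerate.\<close>

lemma word_eq_if_rows_eq:
  assumes nondeg: "\<And>x. (\<And>k. k \<in> I \<Longrightarrow> comb x \<bullet> u k = 0) \<Longrightarrow> comb x = 0\<^sub>v n"
    and "set is \<subseteq> I" "set js \<subseteq> I"
    and rows: "\<And>j k. j \<in> I \<Longrightarrow> k \<in> I \<Longrightarrow>
      gram_row gram I (reflects gram I (rev is) (basis_fun j)) k
      = gram_row gram I (reflects gram I (rev js) (basis_fun j)) k"
    and v: "v \<in> carrier_vec n"
  shows "word is v = word js v"
proof -
  have eq: "comb x = comb y" if "\<And>k. k \<in> I \<Longrightarrow> comb x \<bullet> u k = comb y \<bullet> u k" for x y
  proof -
    have "comb (\<lambda>i. x i - y i) = 0\<^sub>v n"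
      using that by (intro nondeg) (simp add: comb_diff minus_scalar_prod_distrib[of _ n])
    then have "comb x - comb y = 0\<^sub>v n" by (simp add: comb_diff)
    then have "(comb x - comb y) $ i = 0" if "i < n" for i using that by simp
    then show ?thesis by (intro eq_vecI) (simp_all add: carrier_vecD[OF comb_carrier])
  qed
  have rev_eq: "word (rev is) (u j) = word (rev js) (u j)" if "j \<in> I" for j
  proof -
    have "comb (reflects gram I (rev is) (basis_fun j)) = comb (reflects gram I (rev js) (basis_fun j))"
    proof (rule eq)
      fix k assume "k \<in> I"
      then show "comb (reflects gram I (rev is) (basis_fun j)) \<bullet> u k
          = comb (reflects gram I (rev js) (basis_fun j)) \<bullet> u k"
        using rows[OF that \<open>k \<in> I\<close>] by (simp add: gram_row_eq_scalar_prod)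
    qed
    then show ?thesis using assms(2,3) that by (simp add: comb_reflects comb_basis)
  qed
  obtain x y where x: "word is v = v + comb x" and y: "word js v = v + comb y"
    using word_displacement assms(2,3) v by meson
  have "comb x = comb y"
  proof (rule eq)
    fix k assume k: "k \<in> I"
    \<comment> \<open>Moving the words across the form leaves products of \<open>v\<close> with
      \<open>word (rev is) (u k)\<close> and \<open>word (rev js) (u k)\<close>, which
      agree.\<close>
    have "word is v \<bullet> u k = word js v \<bullet> u k"
      using assms(2,3) k v by (simp add: word_scalar_prod rev_eq)
    then show "comb x \<bullet> u k = comb y \<bullet> u k"
      unfolding x y using v k by (simp add: add_scalar_prod_distrib[of _ n])
  qed
  then show ?thesis by (simp add: x y)
qed

end

subsection \<open>Reflective representations\<close>

lemma group_GL: "group (GL n)"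
  unfolding GL_def by (rule monoid.units_group) (simp add: ring_mat ring.is_monoid)

lemma GL_carrier: "x \<in> carrier (GL n) \<Longrightarrow> x \<in> carrier_mat n n"
  by (simp add: GL_def units_of_carrier Units_def ring_mat_simps)

lemma GL_mult: "x \<otimes>\<^bsub>GL n\<^esub> y = x * y"
  by (simp add: GL_def units_of_mult ring_mat_simps)

lemma GL_one: "\<one>\<^bsub>GL n\<^esub> = 1\<^sub>m n"
  by (simp add: GL_def units_of_one ring_mat_simps)

lemma GL_pow_mult_vec:
  assumes "x \<in> carrier (GL n)" "v \<in> carrier_vec n"
  shows "(x [^]\<^bsub>GL n\<^esub> (k::nat)) *\<^sub>v v = ((\<lambda>v. x *\<^sub>v v) ^^ k) v"
  using assms(2)
proof (induction k arbitrary: v)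
  case 0
  interpret group "GL n" by (rule group_GL)
  show ?case using 0 by (simp add: GL_one)
next
  case (Suc k)
  interpret group "GL n" by (rule group_GL)
  have "x [^]\<^bsub>GL n\<^esub> k \<in> carrier_mat n n" using assms GL_carrier by simp
  then have "(x [^]\<^bsub>GL n\<^esub> Suc k) *\<^sub>v v = (x [^]\<^bsub>GL n\<^esub> k) *\<^sub>v (x *\<^sub>v v)"
    using GL_carrier[OF assms(1)] Suc.prems by (simp add: GL_mult)
  also have "\<dots> = ((\<lambda>v. x *\<^sub>v v) ^^ k) (x *\<^sub>v v)"
    using GL_carrier[OF assms(1)] Suc by simp
  finally show ?case by (simp add: funpow_swap1)
qed

lemma mat_eq_if_mult_vec_eq:
  fixes A B :: "'a::comm_semiring_1 mat"
  assumes "A \<in> carrier_mat m n" "B \<in> carrier_mat m n"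
    and "\<And>v. v \<in> carrier_vec n \<Longrightarrow> A *\<^sub>v v = B *\<^sub>v v"
  shows "A = B"
proof (rule eq_matI)
  fix i j assume ij: "i < dim_row B" "j < dim_col B"
  have "(C *\<^sub>v unit_vec n j) $ i = C $$ (i, j)" if "C \<in> carrier_mat m n" for C :: "'a mat"
    using ij assms that by (simp add: scalar_prod_right_unit)
  then show "A $$ (i, j) = B $$ (i, j)" using assms by (metis unit_vec_carrier)
qed (use assms in auto)

text \<open>Pigeonhole on the powers of \<open>\<rho> x\<close>: two of them coincide, and
  cancelling leaves a positive exponent.\<close>

lemma torsion_if_finite_image:
  assumes "group F" "group H" "\<rho> \<in> hom F H" "finite (\<rho> ` carrier F)" "x \<in> carrier F"
  shows "torsion_element H (\<rho> x)"
proof -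
  interpret F: group F by fact
  interpret H: group H by fact
  interpret group_hom F H \<rho> using assms by (simp add: group_hom_def group_hom_axioms_def)
  have "\<rho> x [^]\<^bsub>H\<^esub> (k::nat) \<in> \<rho> ` carrier F" for k
    using assms(5) by (metis F.nat_pow_closed hom_nat_pow imageI)
  then have "finite (range (\<lambda>k::nat. \<rho> x [^]\<^bsub>H\<^esub> k))"
    by (intro finite_subset[OF _ assms(4)]) auto
  then have "\<not> inj (\<lambda>k::nat. \<rho> x [^]\<^bsub>H\<^esub> k)" using finite_imageD by blast
  then obtain i j :: nat where ij: "i < j" "\<rho> x [^]\<^bsub>H\<^esub> i = \<rho> x [^]\<^bsub>H\<^esub> j"
    by (metis (mono_tags, lifting) injI linorder_neqE_nat)
  have "\<rho> x [^]\<^bsub>H\<^esub> (j - i) \<otimes>\<^bsub>H\<^esub> \<rho> x [^]\<^bsub>H\<^esub> i = \<rho> x [^]\<^bsub>H\<^esub> (j - i + i)"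
    using assms(5) by (intro H.nat_pow_mult) simp
  also have "\<dots> = \<rho> x [^]\<^bsub>H\<^esub> i" using ij by simp
  finally have "\<rho> x [^]\<^bsub>H\<^esub> (j - i) = \<one>\<^bsub>H\<^esub>"
    using assms(5) by simp
  then show ?thesis
    using ij(1) assms(5) unfolding torsion_element_def by (auto intro!: exI[of _ "j - i"])
qed

locale reflective_representation = reflection_tuple +
  fixes F :: "('a, 'm) monoid_scheme" and \<gamma> :: "nat \<Rightarrow> 'a" and \<rho> :: "'a \<Rightarrow> complex mat"
  assumes group_F: "group F"
    and generators: "\<gamma> \<in> I \<rightarrow> carrier F"
    and generated: "generate F (\<gamma> ` I) = carrier F"
    and hom: "\<rho> \<in> hom F (GL n)"
    and action: "\<And>i v. i \<in> I \<Longrightarrow> v \<in> carrier_vec n \<Longrightarrow> \<rho> (\<gamma> i) *\<^sub>v v = refl_vec (u i) v"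
begin

sublocale group_hom F "GL n" \<rho>
  by (simp add: group_hom_def group_hom_axioms_def group_F group_GL hom)

lemma rho_carrier [simp]: "x \<in> carrier F \<Longrightarrow> \<rho> x \<in> carrier_mat n n"
  using hom_closed GL_carrier by blast

lemma rho_mult_vec:
  assumes "x \<in> carrier F" "y \<in> carrier F" "v \<in> carrier_vec n"
  shows "\<rho> (x \<otimes>\<^bsub>F\<^esub> y) *\<^sub>v v = \<rho> x *\<^sub>v (\<rho> y *\<^sub>v v)"
  using assms by (simp add: GL_mult assoc_mult_mat_vec[of _ n n _ n])

lemma rho_one_vec: "v \<in> carrier_vec n \<Longrightarrow> \<rho> \<one>\<^bsub>F\<^esub> *\<^sub>v v = v"
  by (simp add: GL_one)

lemma list_mult_closed: "set is \<subseteq> I \<Longrightarrow> list_mult F (map \<gamma> is) \<in> carrier F"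
  using generators by (induction "is") (auto simp: list_mult_def)

lemma rho_list_mult:
  assumes "set is \<subseteq> I" "v \<in> carrier_vec n"
  shows "\<rho> (list_mult F (map \<gamma> is)) *\<^sub>v v = word is v"
  using assms(1)
proof (induction "is")
  case Nil
  then show ?case using assms(2) rho_one_vec by (simp add: list_mult_def)
next
  case (Cons i "is")
  have "list_mult F (map \<gamma> (i # is)) = \<gamma> i \<otimes>\<^bsub>F\<^esub> list_mult F (map \<gamma> is)"
    by (simp add: list_mult_def)
  moreover have "\<gamma> i \<in> carrier F" "list_mult F (map \<gamma> is) \<in> carrier F"
    using Cons.prems generators list_mult_closed by auto
  ultimately show ?case
    using Cons assms(2) by (simp add: rho_mult_vec action del: hom_mult)
qed

text \<open>Reflections are involutions, so the inverse of a generator acts like the generator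
  itself and words without inverse letters suffice.\<close>

lemma rho_eq_word:
  assumes "x \<in> carrier F"
  shows "\<exists>is. set is \<subseteq> I \<and> (\<forall>v\<in>carrier_vec n. \<rho> x *\<^sub>v v = word is v)"
  using assms[folded generated]
proof (induction x rule: generate.induct)
  case one
  then show ?case using rho_one_vec by (intro exI[of _ "[]"]) simp
next
  case (incl h)
  then obtain i where i: "i \<in> I" "h = \<gamma> i" by auto
  then show ?case by (intro exI[of _ "[i]"]) (simp add: action)
next
  case (inv h)
  then obtain i where i: "i \<in> I" "h = \<gamma> i" by auto
  then have \<gamma>i: "\<gamma> i \<in> carrier F" using generators by auto
  have "\<rho> (inv\<^bsub>F\<^esub> \<gamma> i) *\<^sub>v v = refl_vec (u i) v" if v: "v \<in> carrier_vec n" for v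
  proof -
    have "v = \<rho> (\<gamma> i) *\<^sub>v refl_vec (u i) v"
      using i v by (simp add: action refl_vec_involution[of _ n] u_unit)
    then have "\<rho> (inv\<^bsub>F\<^esub> \<gamma> i) *\<^sub>v v = \<rho> (inv\<^bsub>F\<^esub> \<gamma> i) *\<^sub>v (\<rho> (\<gamma> i) *\<^sub>v refl_vec (u i) v)"
      by simp
    also have "\<dots> = \<rho> (inv\<^bsub>F\<^esub> \<gamma> i \<otimes>\<^bsub>F\<^esub> \<gamma> i) *\<^sub>v refl_vec (u i) v"
      using i v \<gamma>i by (intro rho_mult_vec[symmetric]) auto
    finally show ?thesis using i v \<gamma>i rho_one_vec by simp
  qed
  then show ?case using i by (intro exI[of _ "[i]"]) simp
next
  case (eng h1 h2)
  then obtain is1 is2 where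
    1: "set is1 \<subseteq> I" "\<forall>v\<in>carrier_vec n. \<rho> h1 *\<^sub>v v = word is1 v" and
    2: "set is2 \<subseteq> I" "\<forall>v\<in>carrier_vec n. \<rho> h2 *\<^sub>v v = word is2 v" by blast
  have "h1 \<in> carrier F" "h2 \<in> carrier F" using eng generated by auto
  then show ?case using 1 2
    by (intro exI[of _ "is1 @ is2"]) (simp add: rho_mult_vec del: hom_mult)
qed

section \<open>Semisimplicity and nondegeneracy on the span of the reflection vectors\<close>

lemma invariant_subspaceD:
  assumes "invariant_subspace F n \<rho> W"
  shows "W \<subseteq> carrier_vec n" "0\<^sub>v n \<in> W"
    "v \<in> W \<Longrightarrow> w \<in> W \<Longrightarrow> v + w \<in> W" "v \<in> W \<Longrightarrow> c \<cdot>\<^sub>v v \<in> W"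
    "i \<in> I \<Longrightarrow> v \<in> W \<Longrightarrow> refl_vec (u i) v \<in> W"
proof -
  have sub: "submodule class_ring W (module_vec TYPE(complex) n)"
    using assms unfolding invariant_subspace_def VectorSpace.subspace_def by simp
  show W: "W \<subseteq> carrier_vec n" and "0\<^sub>v n \<in> W"
    "v \<in> W \<Longrightarrow> w \<in> W \<Longrightarrow> v + w \<in> W" "v \<in> W \<Longrightarrow> c \<cdot>\<^sub>v v \<in> W"
    using submodule.subset[OF sub] submodule.zero_closed[OF sub] submodule.m_closed[OF sub]
      submodule.smult_closed[OF sub]
    by (auto simp: module_vec_simps class_ring_simps)
  assume "i \<in> I" "v \<in> W"
  then show "refl_vec (u i) v \<in> W"
    using assms generators W action[of i v] unfolding invariant_subspace_def by (metis PiE subsetD)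
qed

text \<open>Vectors orthogonal to all \<open>u i\<close> are fixed by every word, hence by the whole
  group. Inside an irreducible component this subspace is therefore zero or everything.\<close>

lemma invariant_subspace_orthogonal:
  assumes W: "invariant_subspace F n \<rho> W"
  shows "invariant_subspace F n \<rho> {w \<in> W. \<forall>i\<in>I. w \<bullet> u i = 0}" (is "invariant_subspace F n \<rho> ?U")
  unfolding invariant_subspace_def VectorSpace.subspace_def
proof (intro conjI ballI)
  note W_simps = invariant_subspaceD[OF W]
  have sub: "submodule class_ring W (module_vec TYPE(complex) n)" "vectorspace class_ring (module_vec TYPE(complex) n)"
    using W unfolding invariant_subspace_def VectorSpace.subspace_def by auto
  then show "vectorspace class_ring (module_vec TYPE(complex) n)" by simp
  have Wc: "w \<in> carrier_vec n" if "w \<in> W" for w using W_simps(1) that by auto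
  show "submodule class_ring ?U (module_vec TYPE(complex) n)"
    unfolding submodule_def
    using submodule.module[OF sub(1)] W_simps Wc
    by (auto simp: module_vec_simps class_ring_simps add_scalar_prod_distrib[of _ n]
        smult_scalar_prod_distrib[of _ n])
  fix x v assume "x \<in> carrier F" "v \<in> ?U"
  then obtain ks where "set ks \<subseteq> I" "\<rho> x *\<^sub>v v = word ks v" using rho_eq_word Wc by blast
  then show "\<rho> x *\<^sub>v v \<in> ?U" using word_fixed[of ks v] \<open>v \<in> ?U\<close> Wc by auto
qed

lemma comb_induct:
  assumes "0\<^sub>v n \<in> Z" "\<And>v w. v \<in> Z \<Longrightarrow> w \<in> Z \<Longrightarrow> v + w \<in> Z" "\<And>c v. v \<in> Z \<Longrightarrow> c \<cdot>\<^sub>v v \<in> Z"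
    and "\<And>i. i \<in> I \<Longrightarrow> u i \<in> Z"
  shows "comb x \<in> Z"
proof -
  have "vec n (\<lambda>k. \<Sum>i\<in>K. x i * u i $ k) \<in> Z" if "finite K" "K \<subseteq> I" for K
    using that
  proof (induction K)
    case empty
    have "vec n (\<lambda>k. \<Sum>i\<in>{}. x i * u i $ k) = 0\<^sub>v n" by (intro eq_vecI) simp_all
    then show ?case using assms(1) by simp
  next
    case (insert i K)
    have "dim_vec (u i) = n" using insert u_carrier carrier_vecD by blast
    then have "(x i \<cdot>\<^sub>v u i) $ k = x i * u i $ k" if "k < n" for k using that by simp
    then have "vec n (\<lambda>k. \<Sum>i\<in>insert i K. x i * u i $ k)
        = x i \<cdot>\<^sub>v u i + vec n (\<lambda>k. \<Sum>i\<in>K. x i * u i $ k)"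
      using insert by (intro eq_vecI) simp_all
    then show ?case using insert assms by simp
  qed
  then show ?thesis using finite_I by (simp add: comb_def)
qed

text \<open>Every component \<open>z\<^sub>j\<close> of a vector \<open>z\<close> in the radical is fixed by all reflections. By
  irreducibility the fixed vectors of \<open>W j\<close> are \<open>0\<close> or all of \<open>W j\<close>; in the latter case
  every \<open>u i\<close>, being negated by its reflection, has trivial component in \<open>W j\<close>.\<close>

lemma nondegenerate_if_semisimple:
  assumes "semisimple_rep F n \<rho>" and orth: "\<And>k. k \<in> I \<Longrightarrow> comb x \<bullet> u k = 0"
  shows "comb x = 0\<^sub>v n"
proof -
  obtain m :: nat and W where decomposition: "(\<forall>j<m. irreducible_subrep F n \<rho> (W j)) \<and>
      (\<forall>v\<in>carrier_vec n. \<exists>!w. w \<in> (\<Pi>\<^sub>E j\<in>{..<m}. W j) \<and> v = finsum_vec TYPE(complex) n w {..<m})"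
    using assms(1) unfolding semisimple_rep_def by (elim exE)
  note irr = conjunct1[OF decomposition, rule_format]
    and uniq = bspec[OF conjunct2[OF decomposition]]
  have inv: "invariant_subspace F n \<rho> (W j)" if "j < m" for j
    using irr[OF that] by (simp add: irreducible_subrep_def)
  note W_closed = invariant_subspaceD[OF inv]
  define P where "P = (\<Pi>\<^sub>E j\<in>{..<m}. W j)"
  define S where "S w = finsum_vec TYPE(complex) n w {..<m}" for w :: "nat \<Rightarrow> complex vec"
  have Pc: "w j \<in> carrier_vec n" if "w \<in> P" "j < m" for w j
    using that W_closed(1) by (auto simp: P_def)
  have S_index: "S w $ k = (\<Sum>j<m. w j $ k)"
    if "\<And>j. j < m \<Longrightarrow> w j \<in> carrier_vec n" "k < n" for w k
    unfolding S_def using that by (intro index_finsum_vec) auto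
  have S_carrier: "S w \<in> carrier_vec n" if "\<And>j. j < m \<Longrightarrow> w j \<in> carrier_vec n" for w
    unfolding S_def using that by (intro finsum_vec_closed) auto
  define part where "part v = (THE w. w \<in> P \<and> v = S w)" for v
  have part: "part v \<in> P" "S (part v) = v" if "v \<in> carrier_vec n" for v
    using theI'[OF uniq[OF that]] unfolding part_def P_def S_def by auto
  have part_eq: "part v = w" if "v \<in> carrier_vec n" "w \<in> P" "S w = v" for v w
    unfolding part_def P_def S_def
    by (rule the1_equality[OF uniq[OF that(1)]]) (use that in \<open>auto simp: P_def S_def\<close>)
  \<comment> \<open>Uniqueness of the decomposition: a family in the spaces \<open>W j\<close> with
    the right coordinate sums is the family of components. Linearity of \<open>part\<close> and its
    compatibility with reflections follow from this.\<close>
  have part_map: "part v' = (\<lambda>j\<in>{..<m}. f j)"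
    if "\<And>j. j < m \<Longrightarrow> f j \<in> W j" "v' \<in> carrier_vec n"
      "\<And>k. k < n \<Longrightarrow> (\<Sum>j<m. f j $ k) = v' $ k" for v' f
  proof (rule part_eq)
    show "(\<lambda>j\<in>{..<m}. f j) \<in> P" using that by (auto simp: P_def)
    have fc: "restrict f {..<m} j \<in> carrier_vec n" if "j < m" for j
      using \<open>restrict f {..<m} \<in> P\<close> Pc that by blast
    show "S (restrict f {..<m}) = v'"
      using S_carrier[of "restrict f {..<m}"] fc that by (intro eq_vecI) (simp_all add: S_index)
  qed (use that in simp)
  have sum_part: "(\<Sum>j<m. part v j $ k) = v $ k" if "v \<in> carrier_vec n" "k < n" for v k
    using S_index[of "part v" k] part[OF that(1)] Pc that by metis
  have part_W: "part v j \<in> W j" if "v \<in> carrier_vec n" "j < m" for v j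
    using part[OF that(1)] that by (auto simp: P_def)
  have part_carrier: "part v j \<in> carrier_vec n" if "v \<in> carrier_vec n" "j < m" for v j
    using part[OF that(1)] that Pc by blast
  have part_dim: "dim_vec (part v j) = n" if "v \<in> carrier_vec n" "j < m" for v j
    using part_carrier[OF that] by (rule carrier_vecD)
  have u_dim: "dim_vec (u i) = n" if "i \<in> I" for i
    using u_carrier[OF that] by (rule carrier_vecD)
  have part_add: "part (v + w) j = part v j + part w j"
    if vw: "v \<in> carrier_vec n" "w \<in> carrier_vec n" and j: "j < m" for v w j
  proof -
    have "part (v + w) = (\<lambda>j\<in>{..<m}. part v j + part w j)"
      using vw part_W W_closed(3) part_carrier[OF vw(1)] part_carrier[OF vw(2)]
      by (intro part_map) (simp_all add: sum.distrib sum_part part_dim)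
    then show ?thesis using j by simp
  qed
  have part_smult: "part (c \<cdot>\<^sub>v v) j = c \<cdot>\<^sub>v part v j"
    if v: "v \<in> carrier_vec n" and j: "j < m" for c v j
  proof -
    have "part (c \<cdot>\<^sub>v v) = (\<lambda>j\<in>{..<m}. c \<cdot>\<^sub>v part v j)"
      using v part_W W_closed(4) part_carrier[OF v]
      by (intro part_map) (simp_all add: sum_part part_dim flip: sum_distrib_left)
    then show ?thesis using j by simp
  qed
  have part_refl: "part (refl_vec (u i) v) j = refl_vec (u i) (part v j)"
    if i: "i \<in> I" and v: "v \<in> carrier_vec n" and j: "j < m" for i v j
  proof -
    have sp: "v \<bullet> u i = (\<Sum>j<m. part v j \<bullet> u i)"
    proof -
      have "(\<Sum>j<m. part v j \<bullet> u i) = (\<Sum>j<m. \<Sum>k<n. part v j $ k * u i $ k)"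
        using i by (simp add: scalar_prod_def u_dim atLeast0LessThan)
      also have "\<dots> = (\<Sum>k<n. \<Sum>j<m. part v j $ k * u i $ k)" by (rule sum.swap)
      also have "\<dots> = (\<Sum>k<n. v $ k * u i $ k)"
        using v by (intro sum.cong refl) (simp add: sum_part flip: sum_distrib_right)
      finally show ?thesis using i by (simp add: scalar_prod_def u_dim atLeast0LessThan)
    qed
    have "part (refl_vec (u i) v) = (\<lambda>j\<in>{..<m}. refl_vec (u i) (part v j))"
    proof (rule part_map)
      fix k assume k: "k < n"
      have "(\<Sum>j<m. refl_vec (u i) (part v j) $ k)
          = (\<Sum>j<m. part v j $ k - (part v j \<bullet> u i) * (2 * u i $ k))"
        using i k part_carrier[OF v] by (intro sum.cong refl) (simp add: refl_vec_def u_dim part_dim)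
      also have "\<dots> = v $ k - (v \<bullet> u i) * (2 * u i $ k)"
        using v k by (simp add: sum_subtractf sum_part sp flip: sum_distrib_right)
      finally show "(\<Sum>j<m. refl_vec (u i) (part v j) $ k) = refl_vec (u i) v $ k"
        using i k v by (simp add: refl_vec_def u_dim part_dim)
    qed (use i v part_W W_closed(5) in auto)
    then show ?thesis using j by simp
  qed
  have "part (comb x) j = 0\<^sub>v n" if j: "j < m" for j
  proof -
    define U where "U = {w \<in> W j. \<forall>i\<in>I. w \<bullet> u i = 0}"
    have "U = {0\<^sub>v n} \<or> U = W j"
      using irr[OF j] invariant_subspace_orthogonal[OF inv[OF j]]
      unfolding irreducible_subrep_def U_def by blast
    moreover have "part (comb x) j \<in> U"
    proof -
      have "part (comb x) j \<bullet> u i = 0" if i: "i \<in> I" for i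
      proof -
        define y where "y = part (comb x) j"
        have y: "y \<in> carrier_vec n" using part_carrier j by (simp add: y_def)
        have "refl_vec (u i) (comb x) = comb x" using i orth by (intro refl_vec_fixed[of _ n]) auto
        then have "refl_vec (u i) y = y" using part_refl[OF i _ j, of "comb x"] by (simp add: y_def)
        \<comment> \<open>The component is fixed by a reflection that negates the product with its
          own vector \<open>u i\<close>, so this product is 0.\<close>
        then have "y \<bullet> u i = refl_vec (u i) y \<bullet> u i" by simp
        also have "\<dots> = - (y \<bullet> u i)"
          using i y by (simp add: refl_vec_def minus_scalar_prod_distrib[of _ n] u_unit)
        finally show ?thesis by (simp add: y_def)
      qed
      then show ?thesis using part_W j by (simp add: U_def)
    qed
    moreover have "part (comb x) j = 0\<^sub>v n" if "U = W j"
    proof -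
      \<comment> \<open>The kernel of the projection to \<open>W j\<close>. It is a linear subspace,
        so it contains \<open>comb x\<close> once it contains every \<open>u i\<close>.\<close>
      define Z where "Z = {v \<in> carrier_vec n. part v j = 0\<^sub>v n}"
      have smult_zero: "c \<cdot>\<^sub>v 0\<^sub>v n = 0\<^sub>v n" for c :: complex by (intro eq_vecI) simp_all
      have "comb x \<in> Z"
      proof (rule comb_induct)
        show "v + w \<in> Z" if "v \<in> Z" "w \<in> Z" for v w
          using that j by (simp add: Z_def part_add)
        show "c \<cdot>\<^sub>v v \<in> Z" if "v \<in> Z" for c v
          using that j by (simp add: Z_def part_smult smult_zero)
        show "0\<^sub>v n \<in> Z"
        proof -
          have "0 \<cdot>\<^sub>v part (0\<^sub>v n) j = 0\<^sub>v n"
            using part_dim[of "0\<^sub>v n" j] j by (intro eq_vecI) simp_all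
          then show ?thesis using part_smult[of "0\<^sub>v n" j 0] j by (simp add: Z_def smult_zero)
        qed
        fix i assume i: "i \<in> I"
        define y where "y = part (u i) j"
        have y: "y \<in> W j" "y \<in> carrier_vec n"
          using part_W part_carrier i j by (auto simp: y_def)
        have "refl_vec (u i) (u i) = (- 1) \<cdot>\<^sub>v u i"
          using i by (intro eq_vecI) (simp_all add: refl_vec_def u_unit)
        then have "(- 1) \<cdot>\<^sub>v y = refl_vec (u i) y"
          using part_refl[OF i _ j, of "u i"] part_smult[of "u i" j "- 1"] i j by (simp add: y_def)
        also have "\<dots> = y"
          using y i \<open>U = W j\<close> by (intro refl_vec_fixed[of _ n]) (auto simp: U_def)
        finally have eq: "((- 1) \<cdot>\<^sub>v y) $ k = y $ k" for k by simp
        have "y $ k = 0" if "k < n" for k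
          using eq[of k] that carrier_vecD[OF y(2)] by simp
        then have "y = 0\<^sub>v n" using y(2) by (intro eq_vecI) auto
        then show "u i \<in> Z" using i by (simp add: Z_def y_def)
      qed
      then show ?thesis by (simp add: Z_def)
    qed
    ultimately show ?thesis by blast
  qed
  then have "comb x $ k = 0" if "k < n" for k
    using sum_part[of "comb x" k] that by simp
  then show ?thesis by (intro eq_vecI) (simp_all add: carrier_vecD[OF comb_carrier])
qed

section \<open>Finiteness of the image and the Burnside property\<close>

lemma finite_image:
  assumes ss: "semisimple_rep F n \<rho>" and "N > 0"
    and tor: "\<And>is v. is \<noteq> [] \<Longrightarrow> sorted_wrt (<) is \<Longrightarrow> set is \<subseteq> I \<Longrightarrow> v \<in> carrier_vec n \<Longrightarrow>
      (word is ^^ N) v = v"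
  shows "finite (\<rho> ` carrier F)"
proof -
  define R where "R = {gram_row gram I (reflects gram I is (basis_fun j)) k | is j k.
    set is \<subseteq> I \<and> j \<in> I \<and> k \<in> I}"
  have "finite R" unfolding R_def using finite_gram_rows[OF \<open>N > 0\<close> tor] .
  have "\<exists>ks. \<forall>M\<in>\<rho> ` carrier F. set (ks M) \<subseteq> I \<and> (\<forall>v\<in>carrier_vec n. M *\<^sub>v v = word (ks M) v)"
    using rho_eq_word by (intro bchoice) auto
  then obtain ks where ks: "\<And>M. M \<in> \<rho> ` carrier F \<Longrightarrow> set (ks M) \<subseteq> I"
    "\<And>M v. M \<in> \<rho> ` carrier F \<Longrightarrow> v \<in> carrier_vec n \<Longrightarrow> M *\<^sub>v v = word (ks M) v"
    by blast
  \<comment> \<open>A table of row values that determines the matrix. The word is reversed because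
    \<open>word_eq_if_rows_eq\<close> compares the reversed words; any choice \<open>ks M\<close> of
    a word for \<open>M\<close> will do.\<close>
  define key where "key M = (\<lambda>p\<in>I \<times> I.
    gram_row gram I (reflects gram I (rev (ks M)) (basis_fun (fst p))) (snd p))" for M
  have "inj_on key (\<rho> ` carrier F)"
  proof (rule inj_onI)
    fix M M' assume M: "M \<in> \<rho> ` carrier F" "M' \<in> \<rho> ` carrier F" and eq: "key M = key M'"
    have rows: "gram_row gram I (reflects gram I (rev (ks M)) (basis_fun j)) k
        = gram_row gram I (reflects gram I (rev (ks M')) (basis_fun j)) k" if "j \<in> I" "k \<in> I" for j k
      using fun_cong[OF eq, of "(j, k)"] that by (simp add: key_def)
    show "M = M'"
    proof (rule mat_eq_if_mult_vec_eq[of _ n n])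
      fix v :: "complex vec" assume v: "v \<in> carrier_vec n"
      show "M *\<^sub>v v = M' *\<^sub>v v"
        using word_eq_if_rows_eq[OF nondegenerate_if_semisimple[OF ss] ks(1)[OF M(1)] ks(1)[OF M(2)] rows v]
          ks(2) M v by simp
    qed (use M in auto)
  qed
  moreover have "key ` \<rho> ` carrier F \<subseteq> (I \<times> I) \<rightarrow>\<^sub>E R"
  proof (intro image_subsetI PiE_I)
    fix M p assume "M \<in> \<rho> ` carrier F" "p \<in> I \<times> I"
    moreover from this obtain j k where "p = (j, k)" "j \<in> I" "k \<in> I" by blast
    ultimately have "key M p = gram_row gram I (reflects gram I (rev (ks M)) (basis_fun j)) k"
      "set (rev (ks M)) \<subseteq> I" "j \<in> I" "k \<in> I"
      using ks(1)[of M] by (auto simp: key_def)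
    then show "key M p \<in> R" unfolding R_def by blast
  qed (simp add: key_def)
  moreover have "finite ((I \<times> I) \<rightarrow>\<^sub>E R)"
    using finite_I \<open>finite R\<close> by (intro finite_PiE) auto
  ultimately show ?thesis using inj_on_finite by blast
qed

text \<open>The second conjunct keeps the iterates in the carrier, which the induction step needs in
  order to apply \<open>rho_list_mult\<close>.\<close>

lemma funpow_rho:
  assumes "set is \<subseteq> I" "v \<in> carrier_vec n"
  shows "((\<lambda>v. \<rho> (list_mult F (map \<gamma> is)) *\<^sub>v v) ^^ k) v = (word is ^^ k) v
    \<and> (word is ^^ k) v \<in> carrier_vec n"
  using assms by (induction k) (simp_all add: rho_list_mult)

lemma finite_image_if_torsion:
  assumes ss: "semisimple_rep F n \<rho>"
    and tor: "\<And>is. is \<noteq> [] \<Longrightarrow> sorted_wrt (<) is \<Longrightarrow> set is \<subseteq> I \<Longrightarrow>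
      torsion_element (GL n) (\<rho> (list_mult F (map \<gamma> is)))"
  shows "finite (\<rho> ` carrier F)"
proof -
  define T where "T = {is. is \<noteq> [] \<and> sorted_wrt (<) is \<and> set is \<subseteq> I}"
  have "finite T"
  proof (rule finite_subset)
    show "T \<subseteq> {is. set is \<subseteq> I \<and> length is \<le> card I}"
      using finite_I by (auto simp: T_def strict_sorted_iff card_mono simp flip: distinct_card)
  qed (rule finite_lists_length_le[OF finite_I])
  have "\<exists>k::nat. k > 0 \<and> (\<forall>v\<in>carrier_vec n. (word is ^^ k) v = v)" if "is \<in> T" for "is"
  proof -
    have *: "is \<noteq> []" "sorted_wrt (<) is" "set is \<subseteq> I" using that by (auto simp: T_def)
    obtain k :: nat where k: "k > 0"
      "\<rho> (list_mult F (map \<gamma> is)) [^]\<^bsub>GL n\<^esub> k = \<one>\<^bsub>GL n\<^esub>"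
      using tor[OF *] unfolding torsion_element_def by blast
    have "(word is ^^ k) v = v" if v: "v \<in> carrier_vec n" for v
      using GL_pow_mult_vec[OF hom_closed[OF list_mult_closed[OF *(3)]] v, of k]
        funpow_rho[OF *(3) v, of k] v by (simp add: k(2) GL_one)
    then show ?thesis using k(1) by blast
  qed
  then obtain k where k: "\<And>is. is \<in> T \<Longrightarrow> k is > (0::nat)"
    "\<And>is v. is \<in> T \<Longrightarrow> v \<in> carrier_vec n \<Longrightarrow> (word is ^^ k is) v = v"
    by metis
  \<comment> \<open>There are finitely many increasing words, so the product of their exponents is a
    common exponent for all of them.\<close>
  show ?thesis
  proof (rule finite_image[OF ss, of "prod k T"])
    show "prod k T > 0" using k(1) by (simp add: prod_pos)
    fix "is" and v :: "complex vec" assume *: "is \<noteq> []" "sorted_wrt (<) is" "set is \<subseteq> I" and v: "v \<in> carrier_vec n"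
    then have "is \<in> T" by (simp add: T_def)
    then have "k is dvd prod k T" using \<open>finite T\<close> by (simp add: dvd_prod_eqI)
    then obtain l where "prod k T = k is * l" by blast
    moreover have "(word is ^^ (k is * l)) v = v"
    proof (induction l)
      case (Suc l)
      have "(word is ^^ (k is * Suc l)) v = (word is ^^ k is) ((word is ^^ (k is * l)) v)"
        by (simp add: funpow_add)
      then show ?case using Suc k(2)[OF \<open>is \<in> T\<close> v] by simp
    qed simp
    ultimately show "(word is ^^ prod k T) v = v" by simp
  qed
qed

end

theorem theorem1p5:
  fixes F :: "('a, 'm) monoid_scheme" and r :: nat and \<gamma> :: "nat \<Rightarrow> 'a"
  assumes "freely_generated F {1..r} \<gamma>"
  shows "burnside_set F (semisimple_reflective_reps F r \<gamma>) (increasing_products F r \<gamma>)"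
proof -
  have F: "group F" "\<gamma> \<in> {1..r} \<rightarrow> carrier F" "generate F (\<gamma> ` {1..r}) = carrier F"
    using assms by (auto simp: freely_generated_def)
  have closed: "increasing_products F r \<gamma> \<subseteq> carrier F"
  proof -
    interpret group F by fact
    have "list_mult F (map \<gamma> is) \<in> carrier F" if "set is \<subseteq> {1..r}" for "is"
      using that F(2) by (induction "is") (auto simp: list_mult_def)
    then show ?thesis by (auto simp: increasing_products_def)
  qed
  have increasing: "list_mult F (map \<gamma> is) \<in> increasing_products F r \<gamma>"
    if "is \<noteq> []" "sorted_wrt (<) is" "set is \<subseteq> {1..r}" for "is"
  proof -
    \<comment> \<open>A strictly increasing list is distinct, so its length is the size of a subset
      of \<open>{1..r}\<close>.\<close>
    have "length is = card (set is)" using that(2) by (simp add: strict_sorted_iff distinct_card)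
    also have "\<dots> \<le> r" using card_mono[OF _ that(3)] by simp
    finally show ?thesis using that unfolding increasing_products_def
      by (auto simp: Suc_le_eq)
  qed
  have iff: "(\<forall>g\<in>increasing_products F r \<gamma>. torsion_element (GL n) (\<rho> g)) \<longleftrightarrow> finite (\<rho> ` carrier F)"
    if rr: "reflective_rep F r \<gamma> n \<rho>" and ss: "semisimple_rep F n \<rho>" for n \<rho>
  proof -
    obtain u where u: "u \<in> {1..r} \<rightarrow> unit_quadric n" "is_reflective_rep_of F r \<gamma> n u \<rho>"
      using rr unfolding reflective_rep_def by blast
    interpret reflective_representation n "{1..r}" u F \<gamma> \<rho>
      unfolding reflective_representation_def reflection_tuple_def reflective_representation_axioms_def
      using F u by (auto simp: unit_quadric_def is_reflective_rep_of_def refl_vec_def)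
    show ?thesis
    proof
      assume "\<forall>g\<in>increasing_products F r \<gamma>. torsion_element (GL n) (\<rho> g)"
      then show "finite (\<rho> ` carrier F)" using finite_image_if_torsion[OF ss] increasing by blast
    next
      assume "finite (\<rho> ` carrier F)"
      then show "\<forall>g\<in>increasing_products F r \<gamma>. torsion_element (GL n) (\<rho> g)"
        using torsion_if_finite_image[OF F(1) group_GL hom] closed by blast
    qed
  qed
  have "group (fst p) \<and> snd p \<in> hom F (fst p) \<and>
      ((\<forall>g\<in>increasing_products F r \<gamma>. torsion_element (fst p) (snd p g)) \<longleftrightarrow> finite (snd p ` carrier F))"
    if p: "p \<in> semisimple_reflective_reps F r \<gamma>" for p
  proof -
    obtain n \<rho> where n: "p = (GL n, \<rho>)" "reflective_rep F r \<gamma> n \<rho>" "semisimple_rep F n \<rho>"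
      using p unfolding semisimple_reflective_reps_def by blast
    have "\<rho> \<in> hom F (GL n)"
      using n(2) unfolding reflective_rep_def is_reflective_rep_of_def by blast
    then show ?thesis using group_GL iff[OF n(2,3)] unfolding n(1) fst_conv snd_conv by blast
  qed
  then show ?thesis using F(1) closed by (simp add: burnside_set_def case_prod_unfold)
qed

end
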